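(* Let $G$ be a graph with maximum degree $\Delta(G)=4$ (loops and multiple edges are allowed). Then $G$ has a strong edge-coloring using at most 22 colors.
   Context: A strong edge-coloring of a graph is an assignment of colors to its edges that is a proper edge-coloring (no two edges sharing an endpoint receive the same color) and, in addition, no two edges of the same color lie on a common path of length three (equivalently, two edges that share an endpoint or are joined by a third edge must receive different colors). Graphs are finite and may contain loops and multiple edges. *)

theory Defs
  imports Main
begin

text \<open>A finite multigraph (loops and parallel edges allowed): vertex set V, edge set E
  (edge identifiers), and an endpoint map ends assigning each edge an (unordered, encoded
  as an ordered) pair of endpoints; a loop has both endpoints equal.\<close>

definition multigraph :: "'v set \<Rightarrow> 'e set \<Rightarrow> ('e \<Rightarrow> 'v \<times> 'v) \<Rightarrow> bool" where
  "multigraph V E ends \<longleftrightarrow> finite V \<and> finite E \<and>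
     (\<forall>e\<in>E. fst (ends e) \<in> V \<and> snd (ends e) \<in> V)"

definition endpoints :: "('e \<Rightarrow> 'v \<times> 'v) \<Rightarrow> 'e \<Rightarrow> 'v set" where
  "endpoints ends e = {fst (ends e), snd (ends e)}"

text \<open>Degree: number of edge-ends at v, so a loop contributes 2.\<close>
definition degree :: "'e set \<Rightarrow> ('e \<Rightarrow> 'v \<times> 'v) \<Rightarrow> 'v \<Rightarrow> nat" where
  "degree E ends v = card {e\<in>E. fst (ends e) = v} + card {e\<in>E. snd (ends e) = v}"

definition max_degree :: "'v set \<Rightarrow> 'e set \<Rightarrow> ('e \<Rightarrow> 'v \<times> 'v) \<Rightarrow> nat" where
  "max_degree V E ends = Max (insert 0 (degree E ends ` V))"

definition strong_conflict :: "'e set \<Rightarrow> ('e \<Rightarrow> 'v \<times> 'v) \<Rightarrow> 'e \<Rightarrow> 'e \<Rightarrow> bool" where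
  "strong_conflict E ends e f \<longleftrightarrow>
     endpoints ends e \<inter> endpoints ends f \<noteq> {} \<or>
     (\<exists>g\<in>E. \<exists>u\<in>endpoints ends e. \<exists>w\<in>endpoints ends f. endpoints ends g = {u, w})"

definition strong_edge_coloring ::
  "'e set \<Rightarrow> ('e \<Rightarrow> 'v \<times> 'v) \<Rightarrow> ('e \<Rightarrow> 'c) \<Rightarrow> bool" where
  "strong_edge_coloring E ends c \<longleftrightarrow>
     (\<forall>e\<in>E. \<forall>f\<in>E. e \<noteq> f \<and> strong_conflict E ends e f \<longrightarrow> c e \<noteq> c f)"

end

theory Submission
  imports Defs
begin

text \<open>Every edge conflicts with at most 24 others. Fix a root \<open>v\<close> of a connected graph, give colours to
  the edges of a small matching \<open>P\<close> away from \<open>v\<close>, and colour the other edges greedily, those far from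
  \<open>v\<close> first. An edge not at \<open>v\<close> has a neighbour \<open>w\<close> closer to \<open>v\<close>, and at least three edges at \<open>w\<close> are
  still uncoloured, so 22 colours suffice. The \<open>k\<close>-th edge at \<open>v\<close> (\<open>k = 1, \<dots>, 4\<close>) then has a free colour
  as soon as its 24 potential conflicts are reduced by \<open>k - 1\<close>, either because conflicting edges
  coincide or because conflicting edges in \<open>P\<close> share a colour. Vertices with fewer than four
  incident edges, parallel edges and triangles need no \<open>P\<close>. In a triangle-free simple 4-regular
  graph each 4-cycle through an edge saves one conflict, and the remaining savings come from \<open>P\<close>,
  which consists of one or two pairs of equally coloured edges at the neighbours of \<open>v\<close> if there is
  a 4-cycle, and of a triple and a pair otherwise.\<close>


section \<open>Adjacency, stars and opposite ends of edges\<close>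

definition adj :: "'e set \<Rightarrow> ('e \<Rightarrow> 'v \<times> 'v) \<Rightarrow> 'v \<Rightarrow> 'v \<Rightarrow> bool" where
  "adj E ends u w \<longleftrightarrow> (\<exists>g\<in>E. endpoints ends g = {u, w})"

definition star :: "'e set \<Rightarrow> ('e \<Rightarrow> 'v \<times> 'v) \<Rightarrow> 'v \<Rightarrow> 'e set" where
  "star E ends v = {e \<in> E. v \<in> endpoints ends e}"

lemma adj_commute: "adj E ends u w \<longleftrightarrow> adj E ends w u"
  by (simp add: adj_def insert_commute)

lemma strong_conflict_iff:
  "strong_conflict E ends e f \<longleftrightarrow>
     (\<exists>u\<in>endpoints ends e. \<exists>w\<in>endpoints ends f. u = w \<or> adj E ends u w)"
  unfolding strong_conflict_def adj_def by blast

lemma strong_conflict_commute: "strong_conflict E ends e f \<longleftrightarrow> strong_conflict E ends f e"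
  unfolding strong_conflict_iff by (metis adj_commute)

lemma finite_star [simp]: "finite E \<Longrightarrow> finite (star E ends v)"
  by (simp add: star_def)

text \<open>Edges with first end \<open>v\<close> and edges with second end \<open>v\<close>
  together form the star and overlap exactly in the loops at \<open>v\<close>, so this is
  inclusion-exclusion.\<close>

lemma degree_star:
  assumes "finite E"
  shows "degree E ends v = card (star E ends v) + card {e \<in> E. endpoints ends e = {v}}"
proof -
  let ?A = "{e\<in>E. fst (ends e) = v}" and ?B = "{e\<in>E. snd (ends e) = v}"
  have "?A \<union> ?B = star E ends v" "?A \<inter> ?B = {e \<in> E. endpoints ends e = {v}}"
    by (auto simp: star_def endpoints_def)
  with card_Un_Int[of ?A ?B] assms show ?thesis
    by (simp add: degree_def)
qed

text \<open>For a loop \<open>f\<close> at \<open>a\<close>, \<open>opp ends a f = a\<close>; if \<open>f\<close> is not at \<open>a\<close> the value is junk.\<close>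

definition opp :: "('e \<Rightarrow> 'v \<times> 'v) \<Rightarrow> 'v \<Rightarrow> 'e \<Rightarrow> 'v" where
  "opp ends a f = (if fst (ends f) = a then snd (ends f) else fst (ends f))"

lemma endpoints_opp: "f \<in> star E ends a \<Longrightarrow> endpoints ends f = {a, opp ends a f}"
  by (auto simp: star_def endpoints_def opp_def)

lemma opp_eqI: "endpoints ends f = {a, u} \<Longrightarrow> opp ends a f = u"
  by (auto simp: endpoints_def opp_def doubleton_eq_iff)

lemma endpointsE:
  obtains a b where "endpoints ends e = {a, b}"
  by (auto simp: endpoints_def)

section \<open>Greedy colouring towards a root\<close>

text \<open>No vertex set is fixed: a vertex matters only if its star is nonempty, and connectedness
  is asked of such vertices alone.\<close>

locale bounded_multigraph =
  fixes E :: "'e set" and ends :: "'e \<Rightarrow> 'v \<times> 'v"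
  assumes finite_E: "finite E"
    and degree_le: "degree E ends v \<le> 4"
    and connected: "\<lbrakk>star E ends u \<noteq> {}; star E ends w \<noteq> {}\<rbrakk>
      \<Longrightarrow> (u, w) \<in> {(p, q). adj E ends p q}\<^sup>*"
begin

abbreviation "St \<equiv> star E ends"
abbreviation "ep \<equiv> endpoints ends"
abbreviation conn (infix "\<frown>" 50) where "u \<frown> w \<equiv> adj E ends u w"
abbreviation "conflict \<equiv> strong_conflict E ends"

text \<open>The neighbourhood of \<open>e\<close> in the square of the line graph.\<close>

definition N :: "'e \<Rightarrow> 'e set" where
  "N e = {f \<in> E. f \<noteq> e \<and> conflict e f}"

text \<open>Conflicts are those of the whole graph, even if the joining edge lies outside
  \<open>D\<close>; this lets partial colourings grow edge by edge.\<close>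

definition coloring_on :: "'e set \<Rightarrow> ('e \<Rightarrow> nat) \<Rightarrow> bool" where
  "coloring_on D c \<longleftrightarrow> D \<subseteq> E \<and> c ` D \<subseteq> {..<22} \<and> (\<forall>e\<in>D. \<forall>f\<in>D. f \<in> N e \<longrightarrow> c e \<noteq> c f)"

abbreviation "colorable \<equiv> \<exists>c. coloring_on E c"

definition matching :: "'e set \<Rightarrow> bool" where
  "matching P \<longleftrightarrow> P \<subseteq> E \<and> (\<forall>e\<in>P. \<forall>f\<in>P. e \<noteq> f \<longrightarrow> ep e \<inter> ep f = {})"

lemma finite_St [simp]: "finite (St v)"
  by (simp add: finite_E)

lemma finite_N [simp]: "finite (N e)"
  by (simp add: finite_E N_def)

lemma card_St_le: "card (St v) \<le> 4"
  using degree_le[of v] degree_star[OF finite_E, of ends v] by simp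

text \<open>A loop occupies two of the four edge-ends at \<open>v\<close>.\<close>

lemma card_St_loop:
  assumes "e \<in> E" "ep e = {v}"
  shows "card (St v) \<le> 3"
proof -
  have "card {e \<in> E. ep e = {v}} \<ge> 1"
    using assms finite_E by (simp add: Suc_le_eq card_gt_0_iff) blast
  then show ?thesis
    using degree_le[of v] degree_star[OF finite_E, of ends v] by simp
qed

lemma card_UN_St_le: "finite Q \<Longrightarrow> card (\<Union>u\<in>Q. St u) \<le> 4 * card Q"
  using card_UN_le[of Q St] sum_bounded_above[of Q "\<lambda>u. card (St u)" 4] card_St_le
  by (metis le_trans mult.commute of_nat_id)

text \<open>A conflicting edge \<open>f\<close> meets the far end of some edge \<open>g\<close>
  other than \<open>e\<close> at an endpoint of \<open>e\<close>: take \<open>g = f\<close> if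
  \<open>e\<close> and \<open>f\<close> touch, and the joining edge otherwise. At most six far ends
  with at most four edges each give the bound 24.\<close>

lemma N_cover:
  assumes "ep e = {a, b}"
  shows "N e \<subseteq> (\<Union>u\<in>opp ends a ` (St a - {e}) \<union> opp ends b ` (St b - {e}). St u)"
proof
  fix f assume f: "f \<in> N e"
  then obtain u w where uw: "u \<in> ep e" "w \<in> ep f" "u = w \<or> u \<frown> w" and fE: "f \<in> E" "f \<noteq> e"
    by (auto simp: N_def strong_conflict_iff)
  have key: "\<exists>u\<in>{a, b}. \<exists>g\<in>St u - {e}. f \<in> St (opp ends u g)"
  proof (cases "ep e \<inter> ep f = {}")
    case False
    then obtain u where "u \<in> ep e" "u \<in> ep f" by blast
    then have "f \<in> St u - {e}" "f \<in> St (opp ends u f)"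
      using fE endpoints_opp[of f E ends u] by (auto simp: star_def)
    then show ?thesis using \<open>u \<in> ep e\<close> assms by blast
  next
    case True
    then obtain g where g: "g \<in> E" "ep g = {u, w}"
      using uw by (auto simp: adj_def)
    then have "g \<noteq> e" using True uw by auto
    then have "g \<in> St u - {e}" "opp ends u g = w"
      using g opp_eqI by (auto simp: star_def)
    then show ?thesis using uw fE assms by (auto simp: star_def)
  qed
  then show "f \<in> (\<Union>u\<in>opp ends a ` (St a - {e}) \<union> opp ends b ` (St b - {e}). St u)"
    by blast
qed

lemma card_opp_le:
  assumes "e \<in> St a"
  shows "card (opp ends a ` (St a - {e})) \<le> card (St a) - 1"
  using card_image_le[of "St a - {e}" "opp ends a"] assms by simp

lemma N_sym_iff: "\<lbrakk>e \<in> E; f \<in> E\<rbrakk> \<Longrightarrow> e \<in> N f \<longleftrightarrow> f \<in> N e"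
  by (auto simp: N_def strong_conflict_commute)

text \<open>The hypothesis counts colours rather than edges, so that equally coloured conflicting
  edges count once.\<close>

lemma coloring_extend:
  assumes "coloring_on D c" "e \<in> E" "e \<notin> D" "card (c ` (N e \<inter> D)) \<le> 21"
  obtains k where "coloring_on (insert e D) (c(e := k))"
proof -
  have "\<not> {..<22} \<subseteq> c ` (N e \<inter> D)"
    using assms(4) card_mono[of "c ` (N e \<inter> D)" "{..<22}"] by auto
  then obtain k where k: "k < 22" "k \<notin> c ` (N e \<inter> D)" by auto
  have "coloring_on (insert e D) (c(e := k))"
    using assms(1-3) k unfolding coloring_on_def
    by (auto simp: N_sym_iff) (auto simp: N_def)
  then show ?thesis by (rule that)
qed

lemma coloring_on_empty [simp]: "coloring_on {} c"
  by (simp add: coloring_on_def)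

lemma matching_empty [simp]: "matching {}"
  by (simp add: matching_def)

lemma matching_insert:
  "matching (insert e P) \<longleftrightarrow>
    e \<in> E \<and> matching P \<and> (\<forall>f\<in>P. f \<noteq> e \<longrightarrow> ep e \<inter> ep f = {})"
proof
  assume "matching (insert e P)"
  then show "e \<in> E \<and> matching P \<and> (\<forall>f\<in>P. f \<noteq> e \<longrightarrow> ep e \<inter> ep f = {})"
    unfolding matching_def by (metis insert_iff insert_subset)
next
  assume *: "e \<in> E \<and> matching P \<and> (\<forall>f\<in>P. f \<noteq> e \<longrightarrow> ep e \<inter> ep f = {})"
  then have "ep g \<inter> ep f = {}" if "g \<in> insert e P" "f \<in> insert e P" "g \<noteq> f" for g f
    using that unfolding matching_def by (metis Int_commute insert_iff)
  then show "matching (insert e P)"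
    using * unfolding matching_def by simp
qed

lemma coloring_on_insert:
  "coloring_on (insert e D) c \<longleftrightarrow>
    e \<in> E \<and> c e < 22 \<and> coloring_on D c \<and> (\<forall>f\<in>D. f \<in> N e \<longrightarrow> c e \<noteq> c f)"
proof -
  have "e \<notin> N e" by (simp add: N_def)
  then show ?thesis
    unfolding coloring_on_def by (auto simp: N_sym_iff) (metis N_sym_iff subsetD)+
qed

text \<open>The rank is the distance to \<open>v\<close>; the first step of a shortest walk
  decreases it.\<close>

lemma ranking_exists:
  assumes "St v \<noteq> {}"
  obtains \<rho> :: "'v \<Rightarrow> nat"
  where "\<And>u. \<lbrakk>St u \<noteq> {}; u \<noteq> v\<rbrakk> \<Longrightarrow> \<exists>w. u \<frown> w \<and> \<rho> w < \<rho> u"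
proof
  let ?R = "{(p, q). p \<frown> q}"
  define \<rho> where "\<rho> u = (LEAST n. (u, v) \<in> ?R ^^ n)" for u
  fix u assume u: "St u \<noteq> {}" "u \<noteq> v"
  then have "\<exists>n. (u, v) \<in> ?R ^^ n"
    using connected[OF u(1) assms] rtrancl_power by blast
  then have *: "(u, v) \<in> ?R ^^ \<rho> u"
    unfolding \<rho>_def by (rule LeastI_ex)
  then obtain m where m: "\<rho> u = Suc m"
    using u(2) by (cases "\<rho> u") auto
  then obtain w where w: "(u, w) \<in> ?R" "(w, v) \<in> ?R ^^ m"
    using * relpow_Suc_D2 by metis
  then have "\<rho> w \<le> m"
    unfolding \<rho>_def by (auto intro: Least_le)
  then show "\<exists>w. u \<frown> w \<and> \<rho> w < \<rho> u"
    using w(1) m by auto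
qed

text \<open>\<open>w\<close> is one of the at most six vertices whose stars cover
  \<open>N e\<close>; the other five account for at most 20 edges.\<close>

lemma card_N_minus_St:
  assumes "e \<in> E" "ep e = {a, b}" "a \<frown> w" "w \<noteq> a" "w \<noteq> b"
  shows "card (N e - St w) \<le> 20"
proof -
  define Q where "Q = opp ends a ` (St a - {e}) \<union> opp ends b ` (St b - {e})"
  have cover: "N e \<subseteq> (\<Union>u\<in>Q. St u)"
    unfolding Q_def by (rule N_cover[OF assms(2)])
  have e: "e \<in> St a" "e \<in> St b"
    using assms(1,2) by (auto simp: star_def)
  have "card Q \<le> 6"
    unfolding Q_def
    using card_Un_le[of "opp ends a ` (St a - {e})" "opp ends b ` (St b - {e})"]
      card_opp_le[OF e(1)] card_opp_le[OF e(2)] card_St_le[of a] card_St_le[of b] by linarith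
  moreover obtain g where g: "g \<in> E" "ep g = {a, w}"
    using assms(3) by (auto simp: adj_def)
  then have "g \<noteq> e" "g \<in> St a" "opp ends a g = w"
    using assms opp_eqI by (auto simp: star_def)
  then have "w \<in> opp ends a ` (St a - {e})"
    by (intro image_eqI[of _ _ g]) auto
  then have "w \<in> Q" unfolding Q_def ..
  moreover have finQ: "finite Q" unfolding Q_def by simp
  ultimately have "card (Q - {w}) \<le> 5"
    by simp
  then have "card (\<Union>u\<in>Q - {w}. St u) \<le> 20"
    using card_UN_St_le[of "Q - {w}"] finQ by simp
  moreover have "N e - St w \<subseteq> (\<Union>u\<in>Q - {w}. St u)"
    using cover by blast
  ultimately show ?thesis
    using card_mono[of "\<Union>u\<in>Q - {w}. St u" "N e - St w"] finQ
    by (meson finite_Diff finite_St finite_UN le_trans)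
qed

lemma card_St_Int_matching:
  assumes "matching P"
  shows "card (St w \<inter> P) \<le> 1"
  using assms by (auto simp: matching_def star_def card_le_Suc0_iff_eq finite_E)

text \<open>Colouring by decreasing distance from \<open>v\<close>, the edges at a vertex \<open>w\<close> closer to \<open>v\<close> are still
  uncoloured, except for at most one in \<open>P\<close>.\<close>

lemma coloring_away_from_root:
  assumes "St v \<noteq> {}" "matching P" "coloring_on P c"
  obtains c' where "coloring_on (P \<union> (E - St v)) c'" "\<And>e. e \<in> P \<Longrightarrow> c' e = c e"
proof -
  obtain \<rho> :: "'v \<Rightarrow> nat"
    where \<rho>: "\<And>u. \<lbrakk>St u \<noteq> {}; u \<noteq> v\<rbrakk> \<Longrightarrow> \<exists>w. u \<frown> w \<and> \<rho> w < \<rho> u"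
    using ranking_exists[OF assms(1)] by blast
  \<comment> \<open>The induction rule adds an edge of largest \<open>r\<close> last; since the
    distance is negated, edges far from \<open>v\<close> are coloured first.\<close>
  define r where "r e = - int (Min (\<rho> ` ep e))" for e
  have fin_ep: "finite (ep e)" "ep e \<noteq> {}" for e
    by (auto simp: endpoints_def)
  have "finite (E - St v)" using finite_E by simp
  then have "E - St v \<subseteq> E - St v \<longrightarrow>
      (\<exists>c'. coloring_on (P \<union> (E - St v)) c' \<and> (\<forall>e\<in>P. c' e = c e))"
  proof (induction rule: finite_ranking_induct[where f = r and P = "\<lambda>S. S \<subseteq> E - St v \<longrightarrow>
        (\<exists>c'. coloring_on (P \<union> S) c' \<and> (\<forall>e\<in>P. c' e = c e))"])
    case empty
    then show ?case using assms(3) by auto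
  next
    case (insert e S)
    show ?case
    proof (cases "insert e S \<subseteq> E - St v \<and> e \<notin> P \<union> S")
      case False
      then show ?thesis using insert.IH by (auto simp: insert_absorb)
    next
      case True
      then obtain c' where c': "coloring_on (P \<union> S) c'" "\<forall>e\<in>P. c' e = c e"
        using insert.IH by auto
      have "Min (\<rho> ` ep e) \<in> \<rho> ` ep e"
        using fin_ep by (intro Min_in) auto
      then obtain a where a: "a \<in> ep e" "Min (\<rho> ` ep e) = \<rho> a" by auto
      then obtain b where b: "ep e = {a, b}" by (auto simp: endpoints_def)
      have "St a \<noteq> {}" "a \<noteq> v"
        using a True by (auto simp: star_def)
      then obtain w where w: "a \<frown> w" "\<rho> w < \<rho> a" using \<rho> by blast
      have "\<rho> a \<le> \<rho> b"
        using a(2) b by (metis Min_le fin_ep(1) finite_imageI imageI insertCI)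
      then have "w \<noteq> a" "w \<noteq> b" using w(2) by auto
      then have "card (N e - St w) \<le> 20"
        using card_N_minus_St b w(1) True by blast
      \<comment> \<open>An edge of \<open>S\<close> at \<open>w\<close> would be closer to
        \<open>v\<close> than \<open>e\<close>, against the order of the induction.\<close>
      moreover have "S \<inter> St w = {}"
      proof (rule ccontr)
        assume "S \<inter> St w \<noteq> {}"
        then obtain f where f: "f \<in> S" "w \<in> ep f" by (auto simp: star_def)
        then have "Min (\<rho> ` ep f) \<le> \<rho> w" using fin_ep by simp
        then show False using insert.hyps(2)[OF f(1)] a(2) w(2) by (simp add: r_def)
      qed
      \<comment> \<open>At most 20 edges off \<open>w\<close> and one edge of \<open>P\<close> at
        \<open>w\<close> are coloured, so at most 21 colours are blocked.\<close>
      then have "N e \<inter> (P \<union> S) \<subseteq> (N e - St w) \<union> (St w \<inter> P)" by blast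
      moreover note card_St_Int_matching[OF assms(2), of w]
      ultimately have "card (N e \<inter> (P \<union> S)) \<le> 21"
        using card_mono[of "(N e - St w) \<union> (St w \<inter> P)" "N e \<inter> (P \<union> S)"]
          card_Un_le[of "N e - St w" "St w \<inter> P"] by simp
      then have "card (c' ` (N e \<inter> (P \<union> S))) \<le> 21"
        using card_image_le[of "N e \<inter> (P \<union> S)" c'] by simp
      then obtain k where "coloring_on (insert e (P \<union> S)) (c'(e := k))"
        using coloring_extend[OF c'(1)] True by blast
      then show ?thesis
        using True c'(2) by (intro impI exI[of _ "c'(e := k)"]) auto
    qed
  qed
  then show ?thesis using that by blast
qed

text \<open>Every colour on \<open>Y\<close> recurs on \<open>X - Y\<close>, so \<open>Y\<close>
  adds nothing to the image.\<close>

lemma card_image_redundant: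
  assumes "finite X" "Y \<subseteq> X" "\<And>y. y \<in> Y \<Longrightarrow> \<exists>x\<in>X - Y. c x = c y"
  shows "card (c ` X) + card Y \<le> card X"
proof -
  have "c ` X \<subseteq> c ` (X - Y)"
  proof
    fix k assume "k \<in> c ` X"
    then obtain x where x: "x \<in> X" "k = c x" by blast
    show "k \<in> c ` (X - Y)"
    proof (cases "x \<in> Y")
      case True
      then obtain x' where "x' \<in> X - Y" "c x' = c x" using assms(3) by blast
      then show ?thesis using x(2) by (metis imageI)
    qed (use x in blast)
  qed
  then have "c ` X = c ` (X - Y)" by blast
  then have "card (c ` X) \<le> card (X - Y)"
    using assms(1) card_image_le[of "X - Y" c] by simp
  moreover have "card (X - Y) = card X - card Y" "card Y \<le> card X"
    using assms(1,2) by (auto intro: card_Diff_subset card_mono dest: finite_subset)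
  ultimately show ?thesis by linarith
qed

text \<open>Colour \<open>fs\<close> in list order. When \<open>f\<close> is reached, the edges
  \<open>ys\<close> behind it are uncoloured, and each edge of \<open>Y f\<close> repeats the colour
  of another edge of \<open>P\<close> in conflict with \<open>f\<close>; hence at most 21 colours
  are blocked.\<close>

lemma coloring_finish_list:
  assumes "coloring_on (E - set fs) c'" "\<And>e. e \<in> P \<Longrightarrow> c' e = c e"
    and "distinct fs" "set fs \<subseteq> E" "P \<inter> set fs = {}" "P \<subseteq> E"
    and "\<And>f. f \<in> set fs \<Longrightarrow> Y f \<subseteq> N f \<inter> P"
    and "\<And>f y. \<lbrakk>f \<in> set fs; y \<in> Y f\<rbrakk> \<Longrightarrow> \<exists>x\<in>N f \<inter> P - Y f. c x = c y"
    and "\<And>xs f ys. fs = xs @ f # ys \<Longrightarrow> card (N f - set ys) \<le> 21 + card (Y f)"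
  shows colorable
  using assms
proof (induction fs arbitrary: c')
  case Nil
  then show ?case by auto
next
  case (Cons f fs)
  let ?D = "E - set (f # fs)" and ?X = "N f - set fs"
  have sub: "P \<subseteq> ?D" using Cons.prems(5,6) by blast
  have X: "N f \<inter> ?D = ?X" by (auto simp: N_def)
  have "card (c' ` ?X) + card (Y f) \<le> card ?X"
  proof (rule card_image_redundant)
    show "Y f \<subseteq> ?X"
      using Cons.prems(5) Cons.prems(7)[of f] by auto
    fix y assume y: "y \<in> Y f"
    then obtain x where x: "x \<in> N f \<inter> P - Y f" "c x = c y"
      using Cons.prems(8)[of f y] by auto
    moreover have "y \<in> P" using y Cons.prems(7)[of f] by auto
    ultimately show "\<exists>x\<in>?X - Y f. c' x = c' y"
      using Cons.prems(2,5) by (intro bexI[of _ x]) auto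
  qed simp
  moreover have "card ?X \<le> 21 + card (Y f)"
    using Cons.prems(9)[of "[]" f fs] by simp
  ultimately have "card (c' ` (N f \<inter> ?D)) \<le> 21" unfolding X by simp
  then obtain k where k: "coloring_on (insert f ?D) (c'(f := k))"
    using coloring_extend[OF Cons.prems(1), of f] Cons.prems(4) by auto
  have "insert f ?D = E - set fs" using Cons.prems(3,4) by auto
  with k have k: "coloring_on (E - set fs) (c'(f := k))" by simp
  show ?case
  proof (rule Cons.IH[OF k])
    show "(c'(f := k)) e = c e" if "e \<in> P" for e
      using Cons.prems(2)[OF that] sub that by auto
    show "distinct fs" "set fs \<subseteq> E" "P \<inter> set fs = {}" "P \<subseteq> E"
      using Cons.prems(3-6) by auto
    show "Y g \<subseteq> N g \<inter> P" if "g \<in> set fs" for g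
      using Cons.prems(7)[of g] that by simp
    show "\<exists>x\<in>N g \<inter> P - Y g. c x = c y" if "g \<in> set fs" "y \<in> Y g" for g y
      using Cons.prems(8)[of g y] that by simp
    show "card (N g - set ys) \<le> 21 + card (Y g)" if "fs = xs @ g # ys" for xs g ys
      using Cons.prems(9)[of "f # xs" g ys] that by simp
  qed
qed

text \<open>The edges at \<open>v\<close> conflict pairwise, so all \<open>length ys\<close> edges
  behind \<open>f\<close> can be subtracted from its conflicts. The allowance therefore shrinks by
  one from each edge to the next.\<close>

lemma coloring_finish:
  assumes "St v \<noteq> {}" "matching P" "coloring_on P c" "P \<inter> St v = {}"
    and "St v = set fs" "distinct fs"
    and "\<And>f. f \<in> set fs \<Longrightarrow> Y f \<subseteq> N f \<inter> P"
    and "\<And>f y. \<lbrakk>f \<in> set fs; y \<in> Y f\<rbrakk> \<Longrightarrow> \<exists>x\<in>N f \<inter> P - Y f. c x = c y"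
    and "\<And>xs f ys. fs = xs @ f # ys \<Longrightarrow> card (N f) \<le> 21 + length ys + card (Y f)"
  shows colorable
proof -
  obtain c' where c': "coloring_on (P \<union> (E - St v)) c'" "\<And>e. e \<in> P \<Longrightarrow> c' e = c e"
    using coloring_away_from_root[OF assms(1-3)] by blast
  have PE: "P \<subseteq> E" using assms(2) by (simp add: matching_def)
  then have "P \<union> (E - St v) = E - set fs" using assms(4,5) by auto
  with c' have c': "coloring_on (E - set fs) c'" "\<And>e. e \<in> P \<Longrightarrow> c' e = c e" by simp_all
  show ?thesis
  proof (rule coloring_finish_list[OF c' assms(6)])
    show "set fs \<subseteq> E" "P \<inter> set fs = {}"
      using assms(4,5) by (auto simp: star_def)
    fix xs f ys assume fs: "fs = xs @ f # ys"
    have "set ys \<subseteq> N f"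
      using fs assms(5,6) by (auto simp: N_def star_def strong_conflict_iff set_eq_iff)
    then have "card (N f - set ys) = card (N f) - length ys"
      using assms(6) fs by (simp add: card_Diff_subset distinct_card)
    then show "card (N f - set ys) \<le> 21 + card (Y f)"
      using assms(9)[OF fs] by simp
  next
    show "Y f \<subseteq> N f \<inter> P" if "f \<in> set fs" for f
      using that by (rule assms(7))
    show "\<exists>x\<in>N f \<inter> P - Y f. c x = c y" if "f \<in> set fs" "y \<in> Y f" for f y
      using that by (rule assms(8))
  qed (simp_all add: PE)
qed

lemma coloring_finish_greedy:
  assumes "St v \<noteq> {}" "St v = set fs" "distinct fs"
    and "\<And>xs f ys. fs = xs @ f # ys \<Longrightarrow> card (N f) \<le> 21 + length ys"
  shows colorable
proof (rule coloring_finish[of v "{}" "\<lambda>_. 0" fs "\<lambda>_. {}"])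
  show "card (N f) \<le> 21 + length ys + card ({} :: 'e set)" if "fs = xs @ f # ys" for xs f ys
    using assms(4)[OF that] by simp
qed (simp_all add: assms(1,3) assms(2)[symmetric] matching_def coloring_on_def)

section \<open>Small stars, loops and parallel edges\<close>

text \<open>An edge at \<open>v\<close> has at most 2 + 3 far ends in its cover, hence at most 20
  conflicts, and the greedy colouring rooted at \<open>v\<close> succeeds.\<close>

lemma colorable_of_small_star:
  assumes "St v \<noteq> {}" "card (St v) \<le> 3"
  shows colorable
proof -
  obtain fs where fs: "set fs = St v" "distinct fs"
    using finite_distinct_list[of "St v"] by auto
  show ?thesis
  proof (rule coloring_finish_greedy[OF assms(1) fs(1)[symmetric] fs(2)])
    fix xs f ys assume "fs = xs @ f # ys"
    then have f: "f \<in> St v" using fs(1) by auto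
    define x where "x = opp ends v f"
    have ep: "ep f = {v, x}" unfolding x_def by (rule endpoints_opp[OF f])
    then have fx: "f \<in> St x" using f by (auto simp: star_def)
    define Q where "Q = opp ends v ` (St v - {f}) \<union> opp ends x ` (St x - {f})"
    have "card Q \<le> (card (St v) - 1) + (card (St x) - 1)"
      unfolding Q_def
      using card_opp_le[OF f] card_opp_le[OF fx] card_Un_le le_trans add_mono by meson
    then have "card Q \<le> 5"
      using assms(2) card_St_le[of x] by linarith
    moreover have "card (\<Union>u\<in>Q. St u) \<le> 4 * card Q"
      by (rule card_UN_St_le) (simp add: Q_def)
    moreover have "card (N f) \<le> card (\<Union>u\<in>Q. St u)"
      by (rule card_mono) (use N_cover[OF ep] in \<open>simp_all add: Q_def\<close>)
    ultimately show "card (N f) \<le> 21 + length ys" by linarith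
  qed
qed

lemma colorable_of_loop:
  assumes "e \<in> E" "ep e = {v}"
  shows colorable
proof (rule colorable_of_small_star)
  show "St v \<noteq> {}" "card (St v) \<le> 3"
    using assms card_St_loop by (auto simp: star_def)
qed

text \<open>Root the colouring at \<open>v\<close>. For an edge from \<open>v\<close> to a vertex
  other than \<open>w\<close>, the parallel edges have the same far end, so five stars cover its
  conflicts. For an edge between \<open>v\<close> and \<open>w\<close>, the cover contains the stars
  of both, which share two edges.\<close>

lemma colorable_of_parallel:
  assumes "e\<^sub>1 \<in> E" "e\<^sub>2 \<in> E" "e\<^sub>1 \<noteq> e\<^sub>2" "ep e\<^sub>1 = {v, w}" "ep e\<^sub>2 = {v, w}"
  shows colorable
proof (cases "v = w")
  case True
  then show ?thesis using colorable_of_loop assms by simp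
next
  case False
  have e12: "e\<^sub>1 \<in> St v" "e\<^sub>2 \<in> St v" "e\<^sub>1 \<in> St w" "e\<^sub>2 \<in> St w"
    using assms by (auto simp: star_def)
  have opp12: "opp ends v e\<^sub>1 = w" "opp ends v e\<^sub>2 = w" "opp ends w e\<^sub>1 = v" "opp ends w e\<^sub>2 = v"
    using assms by (auto intro!: opp_eqI)
  have "card {e\<^sub>1, e\<^sub>2} \<le> card (St v \<inter> St w)"
    using e12 by (intro card_mono) auto
  then have vw: "card (St v \<union> St w) \<le> 6"
    using card_Un_Int[of "St v" "St w"] card_St_le[of v] card_St_le[of w] assms(3) by simp
  obtain fs where fs: "set fs = St v" "distinct fs"
    using finite_distinct_list[of "St v"] by auto
  have "St v \<noteq> {}" using e12 by auto
  then show ?thesis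
  proof (rule coloring_finish_greedy[OF _ fs(1)[symmetric] fs(2)])
    fix xs f ys assume "fs = xs @ f # ys"
    then have f: "f \<in> St v" using fs(1) by auto
    define x where "x = opp ends v f"
    have ep: "ep f = {v, x}" unfolding x_def by (rule endpoints_opp[OF f])
    then have fx: "f \<in> St x" using f by (auto simp: star_def)
    define Q where "Q = opp ends v ` (St v - {f}) \<union> opp ends x ` (St x - {f})"
    have finQ: "finite Q" by (simp add: Q_def)
    have sub: "N f \<subseteq> (\<Union>u\<in>Q. St u) - {f}"
      using N_cover[OF ep] by (auto simp: Q_def N_def)
    have cx: "card (opp ends x ` (St x - {f})) \<le> 3"
      using card_opp_le[OF fx] card_St_le[of x] by linarith
    have "card (N f) \<le> 21"
    proof (cases "x = w")
      case True
      have "\<exists>g\<in>{e\<^sub>1, e\<^sub>2}. g \<noteq> f" using assms(3) by auto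
      then have "v \<in> Q" "w \<in> Q"
        using e12 opp12 unfolding Q_def True by (force intro: rev_image_eqI)+
      have "card (opp ends v ` (St v - {f})) \<le> 3"
        using card_opp_le[OF f] card_St_le[of v] by linarith
      then have "card Q \<le> 6"
        using cx card_Un_le[of "opp ends v ` (St v - {f})" "opp ends x ` (St x - {f})"]
        unfolding Q_def by linarith
      have "card (Q - {v, w}) \<le> 4"
        using \<open>v \<noteq> w\<close> \<open>v \<in> Q\<close> \<open>w \<in> Q\<close> \<open>card Q \<le> 6\<close> finQ by (simp add: card_Diff_subset)
      then have "card (\<Union>u\<in>Q - {v, w}. St u) \<le> 16"
        using card_UN_St_le[of "Q - {v, w}"] finQ by simp
      then have "card ((St v \<union> St w) \<union> (\<Union>u\<in>Q - {v, w}. St u)) \<le> 22"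
        using vw card_Un_le[of "St v \<union> St w" "\<Union>u\<in>Q - {v, w}. St u"] by linarith
      \<comment> \<open>The bound 6 + 16 includes \<open>f\<close> itself, which leaves 21
        conflicts.\<close>
      moreover have "insert f (N f) \<subseteq> (St v \<union> St w) \<union> (\<Union>u\<in>Q - {v, w}. St u)"
        using sub f by auto
      ultimately have "card (insert f (N f)) \<le> 22"
        using card_mono[of "(St v \<union> St w) \<union> (\<Union>u\<in>Q - {v, w}. St u)" "insert f (N f)"] finQ
        by simp
      then show ?thesis by (simp add: N_def finite_E)
    next
      case False
      then have ne: "e\<^sub>1 \<noteq> f" "e\<^sub>2 \<noteq> f"
        using opp12 by (auto simp: x_def)
      have "opp ends v ` (St v - {f}) = opp ends v ` (St v - {f} - {e\<^sub>2})"
        using opp12 e12 ne assms(3) by (auto simp: image_iff) 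
      then have "card (opp ends v ` (St v - {f})) \<le> card (St v - {f} - {e\<^sub>2})"
        by (metis card_image_le finite_Diff finite_St)
      also have "\<dots> \<le> 2"
        using f e12 ne card_St_le[of v] by simp
      finally have "card Q \<le> 5"
        using cx card_Un_le[of "opp ends v ` (St v - {f})" "opp ends x ` (St x - {f})"]
        unfolding Q_def by linarith
      then have "card (\<Union>u\<in>Q. St u) \<le> 20"
        using card_UN_St_le[OF finQ] by linarith
      moreover have "card (N f) \<le> card (\<Union>u\<in>Q. St u)"
        by (rule card_mono) (use sub finQ in auto)
      ultimately show ?thesis by linarith
    qed
    then show "card (N f) \<le> 21 + length ys" by simp
  qed
qed

end

section \<open>Simple 4-regular graphs\<close>

locale simple_regular = bounded_multigraph E ends
  for E :: "'e set" and ends :: "'e \<Rightarrow> 'v \<times> 'v" +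
  assumes no_loop [simp]: "\<not> u \<frown> u"
    and no_parallel: "\<lbrakk>e \<in> E; f \<in> E; ep e = ep f\<rbrakk> \<Longrightarrow> e = f"
    and regular: "St u \<noteq> {} \<Longrightarrow> card (St u) = 4"
begin

definition nb :: "'v \<Rightarrow> 'v set" where "nb u = {w. u \<frown> w}"

text \<open>Meaningful only for adjacent \<open>u\<close> and \<open>w\<close>; uniqueness comes
  from the absence of parallel edges.\<close>

definition ed :: "'v \<Rightarrow> 'v \<Rightarrow> 'e" where "ed u w = (THE e. e \<in> E \<and> ep e = {u, w})"

lemma mem_nb [simp]: "w \<in> nb u \<longleftrightarrow> u \<frown> w"
  by (simp add: nb_def)

lemma
  assumes "u \<frown> w"
  shows ed_in [simp]: "ed u w \<in> E" and ep_ed [simp]: "ep (ed u w) = {u, w}"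
proof -
  have "\<exists>!e. e \<in> E \<and> ep e = {u, w}"
    using assms no_parallel by (auto simp: adj_def)
  from theI'[OF this] show "ed u w \<in> E" "ep (ed u w) = {u, w}"
    by (simp_all add: ed_def)
qed

lemma ed_unique: "\<lbrakk>e \<in> E; ep e = {u, w}\<rbrakk> \<Longrightarrow> e = ed u w"
  unfolding ed_def by (rule the_equality[symmetric]) (auto intro: no_parallel)

lemma ed_eq_iff: "\<lbrakk>u \<frown> w; p \<frown> q\<rbrakk> \<Longrightarrow> ed u w = ed p q \<longleftrightarrow> {u, w} = {p, q}"
  by (metis ep_ed ed_in no_parallel)

lemma St_eq: "St u = ed u ` nb u"
proof (intro set_eqI iffI)
  fix f assume f: "f \<in> St u"
  then have ep: "ep f = {u, opp ends u f}" and "f \<in> E"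
    using endpoints_opp by (force simp: star_def)+
  then have "f = ed u (opp ends u f)" "u \<frown> opp ends u f"
    using ed_unique by (auto simp: adj_def)
  then show "f \<in> ed u ` nb u" by force
qed (auto simp: star_def)

lemma inj_on_ed: "inj_on (ed u) (nb u)"
  by (auto simp: inj_on_def ed_eq_iff doubleton_eq_iff)

lemma card_nb_St: "card (nb u) = card (St u)"
  by (simp add: St_eq card_image inj_on_ed)

lemma finite_nb [simp]: "finite (nb u)"
  using finite_St[of u] by (simp add: St_eq finite_image_iff inj_on_ed)

lemma card_nb: "u \<frown> w \<Longrightarrow> card (nb u) = 4"
  by (metis St_eq card_nb_St empty_iff image_is_empty mem_nb regular)

lemma nb_cases:
  assumes "v \<frown> x" "v \<frown> y" "x \<noteq> y"
  obtains a b where "nb v = {x, y, a, b}" "distinct [x, y, a, b]"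
proof -
  have "card (nb v - {x, y}) = 2"
    using assms card_nb[OF assms(1)] by (simp add: card_Diff_subset)
  then obtain a b where ab: "nb v - {x, y} = {a, b}" "a \<noteq> b"
    by (auto simp: card_2_iff)
  have "{x, y} \<subseteq> nb v" using assms by simp
  then have "nb v = {x, y, a, b}" using ab by blast
  moreover have "distinct [x, y, a, b]" using assms ab by auto
  ultimately show ?thesis by (rule that)
qed

lemma opp_ed [simp]: "u \<frown> w \<Longrightarrow> opp ends u (ed u w) = w"
  by (rule opp_eqI) simp

lemma N_ed_cover:
  assumes "v \<frown> x"
  shows "N (ed v x) \<subseteq> (\<Union>u\<in>nb v - {x}. St u) \<union> (\<Union>u\<in>nb x - {v}. St u)"
proof -
  have 1: "opp ends v ` (St v - {ed v x}) \<subseteq> nb v - {x}"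
    using assms by (auto simp: St_eq)
  have "opp ends x ` (St x - {ed v x}) \<subseteq> nb x - {v}"
    using assms by (auto simp: St_eq) (auto simp: ed_eq_iff adj_commute)
  with 1 have "(\<Union>u\<in>opp ends v ` (St v - {ed v x}) \<union> opp ends x ` (St x - {ed v x}). St u)
      \<subseteq> (\<Union>u\<in>(nb v - {x}) \<union> (nb x - {v}). St u)"
    by (intro UN_mono Un_mono) auto
  then show ?thesis
    using N_cover[OF ep_ed[OF assms]] by (simp only: UN_Un)
qed

lemma in_N_ed:
  assumes "v \<frown> x" "p \<frown> q"
  shows "ed p q \<in> N (ed v x) \<longleftrightarrow> {p, q} \<noteq> {v, x} \<and>
    (p = v \<or> p = x \<or> q = v \<or> q = x \<or> v \<frown> p \<or> v \<frown> q \<or> x \<frown> p \<or> x \<frown> q)"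
  using assms by (auto simp: N_def strong_conflict_iff ed_eq_iff)

lemma card_UN_St_nb:
  assumes "v \<frown> x"
  shows "card (\<Union>u\<in>nb v - {x}. St u) \<le> 12"
  using card_UN_St_le[of "nb v - {x}"] card_nb[OF assms] assms by simp

text \<open>The edges at \<open>v\<close> are coloured in the order of the indices. Behind them 3,
  2, 1 and 0 edges of the star are still uncoloured, whence the allowances 24, 23, 22 and
  21.\<close>

lemma finish_four:
  assumes "nb v = {x\<^sub>1, x\<^sub>2, x\<^sub>3, x\<^sub>4}" "distinct [x\<^sub>1, x\<^sub>2, x\<^sub>3, x\<^sub>4]"
    and "matching P" "coloring_on P c" "P \<inter> St v = {}"
    and "\<And>x. v \<frown> x \<Longrightarrow> Y x \<subseteq> N (ed v x) \<inter> P"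
    and "\<And>x y. \<lbrakk>v \<frown> x; y \<in> Y x\<rbrakk> \<Longrightarrow> \<exists>z\<in>N (ed v x) \<inter> P - Y x. c z = c y"
    and "card (N (ed v x\<^sub>1)) \<le> 24 + card (Y x\<^sub>1)" "card (N (ed v x\<^sub>2)) \<le> 23 + card (Y x\<^sub>2)"
    and "card (N (ed v x\<^sub>3)) \<le> 22 + card (Y x\<^sub>3)" "card (N (ed v x\<^sub>4)) \<le> 21 + card (Y x\<^sub>4)"
  shows colorable
proof -
  let ?fs = "map (ed v) [x\<^sub>1, x\<^sub>2, x\<^sub>3, x\<^sub>4]"
  have nb: "v \<frown> x \<longleftrightarrow> x \<in> {x\<^sub>1, x\<^sub>2, x\<^sub>3, x\<^sub>4}" for x
    using assms(1) by (metis mem_nb)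
  have set: "set ?fs = St v" by (simp add: St_eq assms(1))
  have mem: "\<exists>x. v \<frown> x \<and> f = ed v x" if "f \<in> set ?fs" for f
    using that by (auto simp: nb)
  show ?thesis
  proof (rule coloring_finish[of v P c ?fs "\<lambda>f. Y (opp ends v f)"])
    show "St v \<noteq> {}" using set by auto
    show "distinct ?fs"
      using assms(2) inj_on_ed[of v] by (auto simp: assms(1) inj_on_def)
    show "Y (opp ends v f) \<subseteq> N f \<inter> P" if "f \<in> set ?fs" for f
      using mem[OF that] assms(6) by (metis opp_ed)
    show "\<exists>z\<in>N f \<inter> P - Y (opp ends v f). c z = c y"
      if "f \<in> set ?fs" "y \<in> Y (opp ends v f)" for f y
      using mem[OF that(1)] that(2) assms(7) by (metis opp_ed)
    show "card (N f) \<le> 21 + length ys + card (Y (opp ends v f))" if "?fs = xs @ f # ys" for xs f ys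
      using that assms(8-11) by (auto simp: Cons_eq_append_conv nb)
  qed (use assms set in auto)
qed

lemma finish_four_greedy:
  assumes "nb v = {x\<^sub>1, x\<^sub>2, x\<^sub>3, x\<^sub>4}" "distinct [x\<^sub>1, x\<^sub>2, x\<^sub>3, x\<^sub>4]"
    and "card (N (ed v x\<^sub>1)) \<le> 24" "card (N (ed v x\<^sub>2)) \<le> 23"
    and "card (N (ed v x\<^sub>3)) \<le> 22" "card (N (ed v x\<^sub>4)) \<le> 21"
  shows colorable
  by (rule finish_four[of v x\<^sub>1 x\<^sub>2 x\<^sub>3 x\<^sub>4 "{}" "\<lambda>_. 0" "\<lambda>_. {}"]) (use assms in simp_all)

lemma card_N_ed_le:
  assumes "v \<frown> x"
  shows "card (N (ed v x)) \<le> 24"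
proof -
  have "card (N (ed v x)) \<le> card ((\<Union>u\<in>nb v - {x}. St u) \<union> (\<Union>u\<in>nb x - {v}. St u))"
    by (rule card_mono[OF _ N_ed_cover[OF assms]]) simp
  then show ?thesis
    using card_UN_St_nb[OF assms] card_UN_St_nb[of x v] assms adj_commute[of E ends v x]
      card_Un_le[of "\<Union>u\<in>nb v - {x}. St u" "\<Union>u\<in>nb x - {v}. St u"] by linarith
qed

text \<open>The third vertex \<open>y\<close> is a far end at both \<open>v\<close> and
  \<open>x\<close>, so five stars cover the conflicts.\<close>

lemma card_N_triangle:
  assumes "v \<frown> x" "v \<frown> y" "x \<frown> y"
  shows "card (N (ed v x)) \<le> 20"
proof -
  let ?Q = "(nb v - {x}) \<union> (nb x - {v})"
  have ne: "v \<noteq> x" "v \<noteq> y" "x \<noteq> y" using assms by auto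
  have "card (nb v - {x}) = 3" "card (nb x - {v}) = 3"
    using assms card_nb[of v x] card_nb[of x v] adj_commute[of E ends v x] by simp_all
  moreover have "card {y} \<le> card ((nb v - {x}) \<inter> (nb x - {v}))"
    by (rule card_mono) (use assms ne in auto)
  ultimately have "card ?Q \<le> 5"
    using card_Un_Int[of "nb v - {x}" "nb x - {v}"] by simp
  then have "card (\<Union>u\<in>?Q. St u) \<le> 20"
    using card_UN_St_le[of ?Q] by simp
  moreover have "card (N (ed v x)) \<le> card (\<Union>u\<in>?Q. St u)"
    by (rule card_mono) (use N_ed_cover[OF assms(1)] in auto)
  ultimately show ?thesis by linarith
qed

text \<open>The two triangle edges at \<open>v\<close> have at most 20 conflicts and come last. Of
  the others, the second needs one saving: the edge between \<open>x\<close> and \<open>y\<close>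
  lies in two stars of its cover.\<close>

lemma colorable_of_triangle:
  assumes "v \<frown> x" "v \<frown> y" "x \<frown> y"
  shows colorable
proof -
  have "x \<noteq> y" using assms by auto
  then obtain a b where ab: "nb v = {x, y, a, b}" "distinct [x, y, a, b]"
    using nb_cases assms by blast
  have va: "v \<frown> a" "v \<frown> b" using ab(1) by (metis insert_iff mem_nb)+
  have "card (N (ed v b)) \<le> 23"
  proof -
    let ?A = "\<Union>u\<in>nb v - {b}. St u" and ?B = "\<Union>u\<in>nb b - {v}. St u"
    have "{ed x y} \<subseteq> St x \<inter> St y" using assms by (auto simp: star_def)
    then have "card {ed x y} \<le> card (St x \<inter> St y)" by (rule card_mono[rotated]) simp
    then have "card (St x \<union> St y) \<le> 7"
      using card_Un_Int[of "St x" "St y"] card_St_le[of x] card_St_le[of y] by simp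
    moreover have "?A = (St x \<union> St y) \<union> St a" using ab by auto
    ultimately have "card ?A \<le> 11"
      using card_Un_le[of "St x \<union> St y" "St a"] card_St_le[of a] by simp
    moreover have "card ?B \<le> 12"
      using va card_UN_St_nb adj_commute[of E ends v b] by blast
    moreover have "card (N (ed v b)) \<le> card (?A \<union> ?B)"
      by (rule card_mono[OF _ N_ed_cover[OF va(2)]]) simp
    ultimately show ?thesis using card_Un_le[of ?A ?B] by linarith
  qed
  moreover have "card (N (ed v y)) \<le> 20"
    using card_N_triangle[of v y x] assms adj_commute[of E ends x y] by blast
  ultimately show ?thesis
    using card_N_ed_le[OF va(1)] card_N_triangle[OF assms] ab
    by (intro finish_four_greedy[of v a b x y]) auto
qed

end

section \<open>Triangle-free graphs\<close>

locale triangle_free = simple_regular E ends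
  for E :: "'e set" and ends :: "'e \<Rightarrow> 'v \<times> 'v" +
  assumes no_triangle: "\<lbrakk>u \<frown> w; w \<frown> z\<rbrakk> \<Longrightarrow> \<not> u \<frown> z"
begin

text \<open>The 4-cycles \<open>v, x, y, u\<close> through the edge \<open>v x\<close>.\<close>

definition quads :: "'v \<Rightarrow> 'v \<Rightarrow> ('v \<times> 'v) set" where
  "quads v x = {(y, u). x \<frown> y \<and> y \<noteq> v \<and> v \<frown> u \<and> u \<noteq> x \<and> y \<frown> u}"

lemma finite_quads [simp]: "finite (quads v x)"
  by (rule finite_subset[of _ "nb x \<times> nb v"]) (auto simp: quads_def)

lemma card_quads_ge: "S \<subseteq> quads v x \<Longrightarrow> card S \<le> card (quads v x)"
  by (simp add: card_mono)

lemma adj_sym: "u \<frown> w \<Longrightarrow> w \<frown> u"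
  by (simp add: adj_commute)

text \<open>The edge \<open>y u\<close> of a 4-cycle is counted twice among the 24 potential conflicts of \<open>v x\<close>.\<close>

lemma card_N_quads:
  assumes "v \<frown> x"
  shows "card (N (ed v x)) + card (quads v x) \<le> 24"
proof -
  let ?A = "\<Union>u\<in>nb v - {x}. St u" and ?B = "\<Union>u\<in>nb x - {v}. St u"
  let ?f = "\<lambda>(y, u). ed y u"
  have inj: "inj_on ?f (quads v x)"
  proof (rule inj_onI, clarify)
    fix y u y' u' assume q: "(y, u) \<in> quads v x" "(y', u') \<in> quads v x" "ed y u = ed y' u'"
    then have "{y, u} = {y', u'}" by (simp add: quads_def ed_eq_iff)
    \<comment> \<open>Equality would close a triangle with \<open>v\<close> and \<open>x\<close>; so
      the edge determines which of its ends is next to \<open>x\<close>.\<close>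
    moreover have "y \<noteq> u'"
      using q assms no_triangle[of v x y] by (auto simp: quads_def)
    ultimately show "y = y' \<and> u = u'" by (auto simp: doubleton_eq_iff)
  qed
  have "?f ` quads v x \<subseteq> ?A \<inter> ?B"
    by (auto simp: quads_def star_def)
  then have "card (quads v x) \<le> card (?A \<inter> ?B)"
    using card_mono[of "?A \<inter> ?B" "?f ` quads v x"] card_image[OF inj] by simp
  moreover have "card (N (ed v x)) \<le> card (?A \<union> ?B)"
    by (rule card_mono[OF _ N_ed_cover[OF assms]]) simp
  moreover have "card ?A + card ?B = card (?A \<union> ?B) + card (?A \<inter> ?B)"
    by (rule card_Un_Int) simp_all
  ultimately show ?thesis
    using card_UN_St_nb[OF assms] card_UN_St_nb[OF adj_sym[OF assms]] by linarith
qed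

text \<open>Each 4-cycle and each redundant edge of \<open>P\<close> saves one of the 24 conflicts;
  the edges in order need 0, 1, 2 and 3 savings.\<close>

lemma finish_four_quads:
  assumes "nb v = {x\<^sub>1, x\<^sub>2, x\<^sub>3, x\<^sub>4}" "distinct [x\<^sub>1, x\<^sub>2, x\<^sub>3, x\<^sub>4]"
    and "matching P" "coloring_on P c" "P \<inter> St v = {}"
    and "\<And>x. v \<frown> x \<Longrightarrow> Y x \<subseteq> N (ed v x) \<inter> P"
    and "\<And>x y. \<lbrakk>v \<frown> x; y \<in> Y x\<rbrakk> \<Longrightarrow> \<exists>z\<in>N (ed v x) \<inter> P - Y x. c z = c y"
    and "1 \<le> card (quads v x\<^sub>2) + card (Y x\<^sub>2)"
    and "2 \<le> card (quads v x\<^sub>3) + card (Y x\<^sub>3)"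
    and "3 \<le> card (quads v x\<^sub>4) + card (Y x\<^sub>4)"
  shows colorable
proof -
  have "v \<frown> x" if "x \<in> {x\<^sub>1, x\<^sub>2, x\<^sub>3, x\<^sub>4}" for x
    using assms(1) that by (metis mem_nb)
  then have "card (N (ed v x)) + card (quads v x) \<le> 24" if "x \<in> {x\<^sub>1, x\<^sub>2, x\<^sub>3, x\<^sub>4}" for x
    using card_N_quads that by blast
  from this[of x\<^sub>1] this[of x\<^sub>2] this[of x\<^sub>3] this[of x\<^sub>4] show ?thesis
    by (intro finish_four[OF assms(1-7)]) (use assms(8-10) in simp_all)
qed

lemma nb_cases3:
  assumes "v \<frown> x" "v \<frown> y" "v \<frown> z" "distinct [x, y, z]"
  obtains t where "nb v = {t, x, y, z}" "distinct [t, x, y, z]"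
proof -
  have "x \<noteq> y" using assms by simp
  then obtain a b where ab: "nb v = {x, y, a, b}" "distinct [x, y, a, b]"
    using nb_cases assms by blast
  moreover have "z = a \<or> z = b"
    using assms ab by (metis distinct_length_2_or_more insertE mem_nb singletonD)
  ultimately show ?thesis
    using that[of a] that[of b] by (auto simp: insert_commute)
qed

section \<open>Triangle-free graphs with a 4-cycle\<close>

text \<open>The fourth neighbour goes first, and the 4-cycles alone supply all savings.\<close>

lemma colorable_of_quads:
  assumes "v \<frown> x" "v \<frown> y" "v \<frown> z" "distinct [x, y, z]"
    and "1 \<le> card (quads v x)" "2 \<le> card (quads v y)" "3 \<le> card (quads v z)"
  shows colorable
proof -
  obtain t where "nb v = {t, x, y, z}" "distinct [t, x, y, z]"
    using nb_cases3[OF assms(1-4)] by blast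
  then show ?thesis
    by (rule finish_four_quads[where P = "{}" and Y = "\<lambda>_. {}"]) (use assms in simp_all)
qed

text \<open>The pairs \<open>a\<close>, \<open>a'\<close> and \<open>b\<close>, \<open>b'\<close>
  are completely joined; \<open>p\<close> and \<open>q\<close> are extra common neighbours of the
  first and the second pair. Rooted at \<open>a\<close>, the edges to \<open>p\<close>,
  \<open>b\<close>, \<open>b'\<close> lie on at least 1, 2, 3 such cycles, the last one using
  \<open>q\<close>.\<close>

lemma colorable_of_grid:
  assumes "a \<noteq> a'" "b \<noteq> b'" "p \<noteq> b" "p \<noteq> b'" "q \<noteq> a" "q \<noteq> a'"
    and "p \<frown> a" "p \<frown> a'" "q \<frown> b" "q \<frown> b'" "a \<frown> b" "a \<frown> b'" "a' \<frown> b" "a' \<frown> b'"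
  shows colorable
proof (rule colorable_of_quads[of a p b b'])
  note sym = assms(7-14)[THEN adj_sym]
  have "{(a', b), (a', b')} \<subseteq> quads a p"
    using assms sym by (auto simp: quads_def)
  then show "1 \<le> card (quads a p)"
    using card_quads_ge[of "{(a', b), (a', b')}" a p] assms(2) by simp
  have "{(a', p), (a', b')} \<subseteq> quads a b"
    using assms sym by (auto simp: quads_def)
  then show "2 \<le> card (quads a b)"
    using card_quads_ge[of "{(a', p), (a', b')}" a b] assms(4) by simp
  have "{(a', p), (a', b), (q, b)} \<subseteq> quads a b'"
    using assms sym by (auto simp: quads_def)
  then show "3 \<le> card (quads a b')"
    using card_quads_ge[of "{(a', p), (a', b), (q, b)}" a b'] assms(3,6) by simp
qed (use assms adj_sym in auto)


text \<open>Otherwise two vertices of \<open>S\<close> and two of \<open>T\<close> form the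
  configuration of \<open>colorable_of_grid\<close>. As \<open>p\<close> and \<open>q\<close> share
  the neighbour \<open>v\<close>, they are not adjacent, which keeps \<open>p\<close> out of
  \<open>T\<close> and \<open>q\<close> out of \<open>S\<close>.\<close>

lemma non_adjacent_pair:
  assumes "\<not> colorable" "v \<frown> p" "v \<frown> q" "S \<subseteq> nb p" "T \<subseteq> nb q" "2 \<le> card S" "2 \<le> card T"
  obtains a b where "a \<in> S" "b \<in> T" "\<not> a \<frown> b"
proof (rule ccontr)
  assume neg: "\<not> thesis"
  obtain a a' where a: "a \<in> S" "a' \<in> S" "a \<noteq> a'"
    using assms(6) card_le_Suc0_iff_eq[of S] by (metis card.infinite not_less_eq_eq numeral_2_eq_2 zero_le)
  obtain b b' where b: "b \<in> T" "b' \<in> T" "b \<noteq> b'"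
    using assms(7) card_le_Suc0_iff_eq[of T] by (metis card.infinite not_less_eq_eq numeral_2_eq_2 zero_le)
  have "\<not> p \<frown> q" using assms(2,3) no_triangle adj_sym by blast
  then have "\<not> q \<frown> p" using adj_sym by blast
  have pa: "p \<frown> a" "p \<frown> a'" "q \<frown> b" "q \<frown> b'" using a b assms(4,5) by auto
  have "a \<frown> b" "a \<frown> b'" "a' \<frown> b" "a' \<frown> b'" using neg that a b by blast+
  then have colorable
    using a(3) b(3) pa \<open>\<not> p \<frown> q\<close> \<open>\<not> q \<frown> p\<close> by (intro colorable_of_grid[of a a' b b' p q]) auto
  then show False using assms(1) by simp
qed

text \<open>The edge from \<open>v\<close> to \<open>i\<close> joins the two edges, unless
  \<open>i = x\<close> and they touch. Hence precoloured edges at neighbours of \<open>v\<close>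
  help all four edges at \<open>v\<close> at once.\<close>

lemma in_N_ed_nb:
  assumes "v \<frown> x" "v \<frown> i" "i \<frown> a" "a \<noteq> v"
  shows "ed i a \<in> N (ed v x)"
  using assms no_loop[of v] by (subst in_N_ed) (auto simp: doubleton_eq_iff)

lemma notin_St_iff: "\<lbrakk>i \<frown> a\<rbrakk> \<Longrightarrow> ed i a \<in> St v \<longleftrightarrow> v = i \<or> v = a"
  by (auto simp: star_def)

text \<open>The two edges at \<open>i\<close> and \<open>j\<close> do not conflict, so they may
  share a colour, which saves one conflict for every edge at \<open>v\<close>. The 4-cycles supply
  the rest for \<open>x\<^sub>3\<close> and \<open>x\<^sub>4\<close>.\<close>

lemma finish_pair:
  assumes "nb v = {x\<^sub>1, x\<^sub>2, x\<^sub>3, x\<^sub>4}" "distinct [x\<^sub>1, x\<^sub>2, x\<^sub>3, x\<^sub>4]"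
    and "1 \<le> card (quads v x\<^sub>3)" "2 \<le> card (quads v x\<^sub>4)"
    and "v \<frown> i" "v \<frown> j" "i \<noteq> j" "i \<frown> a" "j \<frown> b" "\<not> j \<frown> a" "\<not> i \<frown> b" "\<not> a \<frown> b"
  shows colorable
proof (rule finish_four_quads[OF assms(1,2),
      where P = "{ed i a, ed j b}" and c = "\<lambda>_. 0" and Y = "\<lambda>_. {ed j b}"])
  have ij: "\<not> i \<frown> j" "\<not> j \<frown> i" using assms(5,6) no_triangle adj_sym by blast+
  have ne: "a \<noteq> v" "b \<noteq> v" "a \<noteq> b" "a \<noteq> j" "b \<noteq> i" "v \<noteq> i" "v \<noteq> j"
    using assms adj_sym ij by auto
  show "matching {ed i a, ed j b}"
    using assms ne by (auto simp: matching_insert)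
  show "coloring_on {ed i a, ed j b} (\<lambda>_. 0)"
    using assms ne ij adj_sym by (auto simp: coloring_on_insert in_N_ed)
  show "{ed i a, ed j b} \<inter> St v = {}"
    using assms ne by (auto simp: notin_St_iff)
  show "{ed j b} \<subseteq> N (ed v x) \<inter> {ed i a, ed j b}" if "v \<frown> x" for x
    using that assms ne in_N_ed_nb by auto
  have "ed i a \<noteq> ed j b"
    using assms ne by (simp add: ed_eq_iff doubleton_eq_iff)
  then show "\<exists>z\<in>N (ed v x) \<inter> {ed i a, ed j b} - {ed j b}. 0 = 0" if "v \<frown> x" for x
    using that assms ne in_N_ed_nb by blast
qed (use assms in simp_all)

lemma card_nb_minus: "v \<frown> x \<Longrightarrow> card (nb x - {v}) = 3"
  using card_nb[of x v] adj_sym[of v x] by simp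

text \<open>A common neighbour \<open>w\<close> of \<open>x\<close> and \<open>y\<close> other than
  \<open>v\<close> closes the 4-cycle \<open>v\<close>, \<open>x\<close>, \<open>w\<close>,
  \<open>y\<close>; cycles through \<open>y\<close> and through \<open>z\<close> are
  different.\<close>

lemma card_quads_codegree:
  assumes "v \<frown> y" "v \<frown> z" "distinct [x, y, z]"
  shows "card (nb x \<inter> nb y - {v}) + card (nb x \<inter> nb z - {v}) \<le> card (quads v x)"
proof -
  let ?S = "\<lambda>y. (\<lambda>w. (w, y)) ` (nb x \<inter> nb y - {v})"
  have "?S y \<union> ?S z \<subseteq> quads v x"
    using assms adj_sym by (auto simp: quads_def)
  moreover have "card (?S y \<union> ?S z) = card (?S y) + card (?S z)"
    by (rule card_Un_disjoint) (use assms in auto)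
  moreover have "card (?S u) = card (nb x \<inter> nb u - {v})" for u
    by (rule card_image) (simp add: inj_on_def)
  ultimately show ?thesis
    using card_quads_ge by metis
qed

text \<open>If any two neighbours of \<open>v\<close> have two further common neighbours, there are
  enough 4-cycles at \<open>v\<close>. Otherwise some pair \<open>i\<close>, \<open>j\<close> has
  enough private neighbours to carry two equally coloured edges.\<close>

lemma colorable_of_quads_pair:
  assumes "v \<frown> x" "v \<frown> y" "x \<noteq> y" "1 \<le> card (quads v x)" "2 \<le> card (quads v y)"
  shows colorable
proof (rule ccontr)
  assume nc: "\<not> colorable"
  obtain s t where st: "nb v = {x, y, s, t}" "distinct [x, y, s, t]"
    using nb_cases[OF assms(1-3)] by blast
  have vst: "v \<frown> s" "v \<frown> t" using st(1) by (metis insert_iff mem_nb)+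
  show False
  proof (cases "\<exists>i j. v \<frown> i \<and> v \<frown> j \<and> i \<noteq> j \<and> card (nb i \<inter> nb j - {v}) \<le> 1")
    case False
    then have ge: "2 \<le> card (nb i \<inter> nb j - {v})" if "v \<frown> i" "v \<frown> j" "i \<noteq> j" for i j
      using False that by (metis Suc_1 not_less_eq_eq)
    have "3 \<le> card (quads v i)" if "v \<frown> i" "v \<frown> j" "v \<frown> k" "distinct [i, j, k]" for i j k
      using card_quads_codegree[of v j k i] ge[of i j] ge[of i k] that by fastforce
    from this[of x y s] this[of y s x] this[of s x y] have colorable
      using assms vst st(2) by (intro colorable_of_quads[of v x y s]) auto
    then show False using nc by simp
  next
    case True
    then obtain i j where ij: "v \<frown> i" "v \<frown> j" "i \<noteq> j" "card (nb i \<inter> nb j - {v}) \<le> 1" by blast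
    \<comment> \<open>Of the three neighbours of \<open>i\<close> other than \<open>v\<close>, at
      most one is shared with \<open>j\<close>.\<close>
    have *: "2 \<le> card (nb i - nb j)" if "v \<frown> i" "v \<frown> j" "card (nb i \<inter> nb j - {v}) \<le> 1" for i j
    proof -
      have eq: "nb i - nb j = (nb i - {v}) - (nb i \<inter> nb j - {v})"
        using that adj_sym by auto
      have "card (nb i - nb j) = 3 - card (nb i \<inter> nb j - {v})"
        unfolding eq using card_nb_minus[OF that(1)] by (subst card_Diff_subset) auto
      then show ?thesis using that(3) by linarith
    qed
    have "2 \<le> card (nb i - nb j)" "2 \<le> card (nb j - nb i)"
      using *[of i j] *[of j i] ij by (simp_all add: Int_commute)
    then obtain a b where ab: "a \<in> nb i - nb j" "b \<in> nb j - nb i" "\<not> a \<frown> b"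
      using non_adjacent_pair[OF nc ij(1,2)] by (metis Diff_subset)
    have colorable
      by (rule finish_pair[of v s t x y i j a b]) (use assms st ab ij in auto)
    then show False using nc by simp
  qed
qed

text \<open>Two pairs of equally coloured edges, one edge at each neighbour of \<open>v\<close>,
  save two conflicts for every edge at \<open>v\<close>. The edge to \<open>x\<^sub>1\<close> comes
  last and takes its third saving from the given 4-cycle.\<close>

lemma colorable_of_quad:
  assumes "v \<frown> x\<^sub>1" "v \<frown> x\<^sub>2" "x\<^sub>1 \<noteq> x\<^sub>2" "x\<^sub>1 \<frown> w" "x\<^sub>2 \<frown> w" "w \<noteq> v"
  shows colorable
proof (rule ccontr)
  assume nc: "\<not> colorable"
  obtain x\<^sub>3 x\<^sub>4 where st: "nb v = {x\<^sub>1, x\<^sub>2, x\<^sub>3, x\<^sub>4}" "distinct [x\<^sub>1, x\<^sub>2, x\<^sub>3, x\<^sub>4]"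
    using nb_cases[OF assms(1-3)] by blast
  have v34: "v \<frown> x\<^sub>3" "v \<frown> x\<^sub>4" using st(1) by (metis insert_iff mem_nb)+
  have q1: "(w, x\<^sub>2) \<in> quads v x\<^sub>1" and q2: "(w, x\<^sub>1) \<in> quads v x\<^sub>2"
    using assms adj_sym by (auto simp: quads_def)
  have ge: "1 \<le> card (quads v x\<^sub>1)" "1 \<le> card (quads v x\<^sub>2)"
    using card_quads_ge[of "{(w, x\<^sub>2)}" v x\<^sub>1] card_quads_ge[of "{(w, x\<^sub>1)}" v x\<^sub>2] q1 q2 by auto
  \<comment> \<open>A second 4-cycle on \<open>v x\<close> would allow
    \<open>colorable_of_quads_pair\<close>, together with whichever of \<open>x\<^sub>1\<close>,
    \<open>x\<^sub>2\<close> differs from \<open>x\<close>.\<close>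
  have le: "card (quads v x) \<le> 1" if "v \<frown> x" for x
    using that colorable_of_quads_pair[of v x\<^sub>1 x] colorable_of_quads_pair[of v x\<^sub>2 x]
      nc ge assms(1-3) by (metis Suc_1 not_less_eq_eq)
  have uniq: "p = r" if "p \<in> quads v x" "r \<in> quads v x" "v \<frown> x" for p r x
    using le[OF that(3)] that(1,2) card_le_Suc0_iff_eq[of "quads v x"] by simp
  \<comment> \<open>A shared neighbour would give a 4-cycle on \<open>v x\<^sub>i\<close> besides
    the one through \<open>w\<close>.\<close>
  have disj: "\<not> x\<^sub>j \<frown> a" if "x\<^sub>i \<frown> a" "a \<noteq> v" "x\<^sub>i = x\<^sub>1 \<or> x\<^sub>i = x\<^sub>2" "x\<^sub>j = x\<^sub>3 \<or> x\<^sub>j = x\<^sub>4" for x\<^sub>i x\<^sub>j a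
  proof
    assume "x\<^sub>j \<frown> a"
    then have "(a, x\<^sub>j) \<in> quads v x\<^sub>i"
      using that st(2) v34 adj_sym by (auto simp: quads_def)
    then show False
      using uniq[of "(a, x\<^sub>j)" x\<^sub>1 "(w, x\<^sub>2)"] uniq[of "(a, x\<^sub>j)" x\<^sub>2 "(w, x\<^sub>1)"] q1 q2 that(3,4)
        assms(1,2) st(2) by auto
  qed
  have diff: "2 \<le> card (nb i - {v} - nb j)" if ij: "v \<frown> i" "v \<frown> j" "i \<noteq> j" for i j
  proof -
    obtain k where "v \<frown> k" "distinct [i, j, k]"
      using nb_cases[OF ij] by (metis distinct_length_2_or_more distinct_singleton insertCI mem_nb)
    then have "card (nb i \<inter> nb j - {v}) \<le> 1"
      using card_quads_codegree[of v j k i] le[OF ij(1)] ij(2) by simp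
    moreover have eq: "nb i - {v} - nb j = (nb i - {v}) - (nb i \<inter> nb j - {v})"
      by auto
    have "card (nb i - {v} - nb j) = 3 - card (nb i \<inter> nb j - {v})"
      unfolding eq using card_nb_minus[OF ij(1)] by (subst card_Diff_subset) auto
    ultimately show ?thesis by linarith
  qed
  \<comment> \<open>Avoiding \<open>nb x\<^sub>2\<close> for \<open>a\<close> and
    \<open>nb x\<^sub>3\<close> for \<open>d\<close> ensures that \<open>a\<close> differs from
    \<open>b\<close> and \<open>c\<close> from \<open>d\<close>; the other ends differ by
    \<open>disj\<close>.\<close>
  obtain a c where ac: "a \<in> nb x\<^sub>1 - {v} - nb x\<^sub>2" "c \<in> nb x\<^sub>3 - {v}" "\<not> a \<frown> c"
    using non_adjacent_pair[OF nc assms(1) v34(1), of "nb x\<^sub>1 - {v} - nb x\<^sub>2" "nb x\<^sub>3 - {v}"]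
      diff[OF assms(1-3)] card_nb_minus[OF v34(1)] by auto
  obtain d b where db: "d \<in> nb x\<^sub>4 - {v} - nb x\<^sub>3" "b \<in> nb x\<^sub>2 - {v}" "\<not> d \<frown> b"
    using non_adjacent_pair[OF nc v34(2) assms(2), of "nb x\<^sub>4 - {v} - nb x\<^sub>3" "nb x\<^sub>2 - {v}"]
      diff[OF v34(2,1)] card_nb_minus[OF assms(2)] st(2) by auto
  have adj: "x\<^sub>1 \<frown> a" "x\<^sub>2 \<frown> b" "x\<^sub>3 \<frown> c" "x\<^sub>4 \<frown> d"
    and nv: "a \<noteq> v" "b \<noteq> v" "c \<noteq> v" "d \<noteq> v"
    and n1: "\<not> x\<^sub>2 \<frown> a" "\<not> x\<^sub>3 \<frown> d"
    using ac db by auto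
  have n2: "\<not> x\<^sub>3 \<frown> a" "\<not> x\<^sub>4 \<frown> a" "\<not> x\<^sub>3 \<frown> b" "\<not> x\<^sub>4 \<frown> b"
    using disj[of x\<^sub>1 a] disj[of x\<^sub>2 b] adj nv by auto
  have n3: "\<not> x\<^sub>1 \<frown> c" "\<not> x\<^sub>2 \<frown> d"
    using disj[of x\<^sub>1 c x\<^sub>3] disj[of x\<^sub>2 d x\<^sub>4] adj nv by auto
  have xx: "\<not> x \<frown> y" if "v \<frown> x" "v \<frown> y" for x y
    using that no_triangle adj_sym by blast
  have vne: "v \<noteq> x\<^sub>1" "v \<noteq> x\<^sub>2" "v \<noteq> x\<^sub>3" "v \<noteq> x\<^sub>4"
    using assms(1,2) v34 by auto
  have ends_ne: "a \<notin> {b, c, d}" "b \<notin> {c, d}" "c \<noteq> d"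
    "a \<notin> {x\<^sub>1, x\<^sub>2, x\<^sub>3, x\<^sub>4}" "b \<notin> {x\<^sub>1, x\<^sub>2, x\<^sub>3, x\<^sub>4}" "c \<notin> {x\<^sub>1, x\<^sub>2, x\<^sub>3, x\<^sub>4}" "d \<notin> {x\<^sub>1, x\<^sub>2, x\<^sub>3, x\<^sub>4}"
    using adj n1 n2 n3 xx assms(1,2) v34 by blast+
  let ?P = "{ed x\<^sub>1 a, ed x\<^sub>3 c, ed x\<^sub>2 b, ed x\<^sub>4 d}" and ?Y = "{ed x\<^sub>3 c, ed x\<^sub>4 d}"
  let ?col = "\<lambda>e. if e = ed x\<^sub>1 a \<or> e = ed x\<^sub>3 c then 0 else (1::nat)"
  have ed_ne: "ed x\<^sub>1 a \<noteq> ed x\<^sub>3 c" "ed x\<^sub>1 a \<noteq> ed x\<^sub>2 b" "ed x\<^sub>1 a \<noteq> ed x\<^sub>4 d"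
     "ed x\<^sub>3 c \<noteq> ed x\<^sub>2 b" "ed x\<^sub>3 c \<noteq> ed x\<^sub>4 d" "ed x\<^sub>2 b \<noteq> ed x\<^sub>4 d"
    using adj ends_ne st(2) by (auto simp: ed_eq_iff doubleton_eq_iff)
  have inN: "?P \<subseteq> N (ed v x)" if "v \<frown> x" for x
    using that adj nv assms(1,2) v34 in_N_ed_nb by auto
  have colorable
  proof (rule finish_four_quads[of v x\<^sub>2 x\<^sub>3 x\<^sub>4 x\<^sub>1 ?P ?col "\<lambda>_. ?Y"])
    show "nb v = {x\<^sub>2, x\<^sub>3, x\<^sub>4, x\<^sub>1}" "distinct [x\<^sub>2, x\<^sub>3, x\<^sub>4, x\<^sub>1]" using st by auto
    show "matching ?P"
      using adj ends_ne st(2) by (auto simp: matching_insert)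
    have "ed x\<^sub>3 c \<notin> N (ed x\<^sub>1 a)" "ed x\<^sub>4 d \<notin> N (ed x\<^sub>2 b)"
      using adj ends_ne st(2) ac(3) db(3) n1 n2 n3 xx[OF assms(1) v34(1)] xx[OF assms(2) v34(2)] adj_sym
      by (auto simp: in_N_ed)
    then show "coloring_on ?P ?col"
      using adj ed_ne by (auto simp: coloring_on_insert)
    show "?P \<inter> St v = {}"
      using adj nv vne by (auto simp: notin_St_iff)
    show "?Y \<subseteq> N (ed v x) \<inter> ?P" if "v \<frown> x" for x
      using inN[OF that] by auto
    show "\<exists>z\<in>N (ed v x) \<inter> ?P - ?Y. ?col z = ?col y" if "v \<frown> x" "y \<in> ?Y" for x y
    proof (cases "y = ed x\<^sub>3 c")
      case True
      then show ?thesis using inN[OF that(1)] ed_ne by (intro bexI[of _ "ed x\<^sub>1 a"]) auto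
    next
      case False
      then have "y = ed x\<^sub>4 d" using that by auto
      then show ?thesis using inN[OF that(1)] ed_ne by (intro bexI[of _ "ed x\<^sub>2 b"]) auto
    qed
  qed (use ge ed_ne in simp_all)
  then show False using nc by simp
qed

section \<open>Triangle-free graphs without 4-cycles\<close>

text \<open>A triple of equally coloured edges at \<open>x\<^sub>1\<close>,
  \<open>x\<^sub>2\<close>, \<open>x\<^sub>3\<close> saves two conflicts for every edge at
  \<open>v\<close>. A pair of equally coloured edges at two neighbours of \<open>x\<^sub>4\<close>
  saves the third for the last edge.\<close>

lemma colorable_of_no_quad:
  assumes "v \<frown> x\<^sub>1"
    and no_quad: "\<And>v x y w. \<lbrakk>v \<frown> x; v \<frown> y; x \<noteq> y; x \<frown> w; y \<frown> w\<rbrakk> \<Longrightarrow> w = v"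
  shows colorable
proof -
  have codeg: "card (nb p \<inter> nb q) \<le> 1" if "p \<noteq> q" for p q
    using no_quad[OF adj_sym adj_sym that] by (auto simp: card_le_Suc0_iff_eq)
  have "card (nb v - {x\<^sub>1}) = 3"
    using card_nb[OF assms(1)] assms(1) by simp
  then obtain x\<^sub>2 where x2: "v \<frown> x\<^sub>2" "x\<^sub>1 \<noteq> x\<^sub>2"
    by (metis DiffE card.empty equals0I insertI1 mem_nb zero_neq_numeral)
  then obtain x\<^sub>3 x\<^sub>4 where st: "nb v = {x\<^sub>1, x\<^sub>2, x\<^sub>3, x\<^sub>4}" "distinct [x\<^sub>1, x\<^sub>2, x\<^sub>3, x\<^sub>4]"
    using nb_cases[OF assms(1) x2] by blast
  have vx: "v \<frown> x\<^sub>1" "v \<frown> x\<^sub>2" "v \<frown> x\<^sub>3" "v \<frown> x\<^sub>4"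
    using st(1) by (metis insert_iff mem_nb)+
  have xx: "\<not> p \<frown> q" if "r \<frown> p" "r \<frown> q" for p q r
    using that no_triangle adj_sym by blast
  have x_ne: "x\<^sub>1 \<noteq> x\<^sub>2" "x\<^sub>1 \<noteq> x\<^sub>3" "x\<^sub>1 \<noteq> x\<^sub>4" "x\<^sub>2 \<noteq> x\<^sub>3" "x\<^sub>2 \<noteq> x\<^sub>4" "x\<^sub>3 \<noteq> x\<^sub>4"
    using st(2) by auto
  have nonempty: "\<exists>y. y \<in> S" if "1 \<le> card S" for S :: "'v set"
    using that by (cases "S = {}") auto
  \<comment> \<open>Without 4-cycles, discarding the neighbours of \<open>p\<close> costs at most
    one element of \<open>S\<close>; all later choices rest on this.\<close>
  have minus: "card S - 1 \<le> card (S - nb p)" if "S \<subseteq> nb q" "p \<noteq> q" for S p q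
  proof -
    have fin: "finite S" using that(1) finite_nb by (rule finite_subset)
    have "card (S \<inter> nb p) \<le> card (nb q \<inter> nb p)"
      using that(1) by (intro card_mono) auto
    then have "card (S \<inter> nb p) \<le> 1" using codeg[OF that(2)[symmetric]] by linarith
    moreover have "card S - card (S \<inter> nb p) \<le> card (S - S \<inter> nb p)"
      using fin by (intro diff_card_le_card_Diff) auto
    moreover have "S - S \<inter> nb p = S - nb p" by auto
    ultimately show ?thesis by simp
  qed
  \<comment> \<open>Pairwise non-adjacent ends are chosen greedily: at least 3 candidates remain for
    \<open>a\<close>, 2 for \<open>b\<close> and 1 for \<open>c\<close>.\<close>
  obtain a where a: "a \<in> nb x\<^sub>1 - {v}"
    using nonempty[of "nb x\<^sub>1 - {v}"] card_nb_minus[OF vx(1)] by auto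
  have a_ne: "a \<noteq> x\<^sub>2" "a \<noteq> x\<^sub>3" using a xx[OF vx(1,2)] xx[OF vx(1,3)] by auto
  have "2 \<le> card (nb x\<^sub>2 - {v} - nb a)"
    using minus[of "nb x\<^sub>2 - {v}" x\<^sub>2 a] card_nb_minus[OF vx(2)] a_ne by simp
  then obtain b where b: "b \<in> nb x\<^sub>2 - {v} - nb a"
    using nonempty[of "nb x\<^sub>2 - {v} - nb a"] by auto
  have b_ne: "b \<noteq> x\<^sub>3" using b xx[OF vx(2,3)] by auto
  have "2 \<le> card (nb x\<^sub>3 - {v} - nb a)"
    using minus[of "nb x\<^sub>3 - {v}" x\<^sub>3 a] card_nb_minus[OF vx(3)] a_ne by simp
  then have "1 \<le> card (nb x\<^sub>3 - {v} - nb a - nb b)"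
    using minus[of "nb x\<^sub>3 - {v} - nb a" x\<^sub>3 b] b_ne by fastforce
  then obtain c where c: "c \<in> nb x\<^sub>3 - {v} - nb a - nb b"
    using nonempty by metis
  have adj3: "x\<^sub>1 \<frown> a" "x\<^sub>2 \<frown> b" "x\<^sub>3 \<frown> c" and nv3: "a \<noteq> v" "b \<noteq> v" "c \<noteq> v"
    and non3: "\<not> a \<frown> b" "\<not> a \<frown> c" "\<not> b \<frown> c"
    using a b c by auto
  have far: "\<not> q \<frown> y" if "p \<frown> y" "y \<noteq> v" "v \<frown> p" "v \<frown> q" "p \<noteq> q" for p q y
    using no_quad[OF that(3-5,1)] that(2) by blast
  have abc4: "x\<^sub>4 \<notin> {a, b, c}"
    using adj3 xx[OF vx(1,4)] xx[OF vx(2,4)] xx[OF vx(3,4)] by auto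
  have "card (nb x\<^sub>4 - {v}) = 3" by (rule card_nb_minus[OF vx(4)])
  then obtain d\<^sub>1 d\<^sub>2 d\<^sub>3 where d: "nb x\<^sub>4 - {v} = {d\<^sub>1, d\<^sub>2, d\<^sub>3}" "d\<^sub>1 \<noteq> d\<^sub>2" "d\<^sub>1 \<noteq> d\<^sub>3" "d\<^sub>2 \<noteq> d\<^sub>3"
    by (auto simp: card_3_iff)
  \<comment> \<open>For \<open>P\<close> to be a matching, the edge at \<open>d\<close> must not end
    in \<open>a\<close>, \<open>b\<close> or \<open>c\<close>; \<open>t d\<close> counts the
    neighbours excluded in this way.\<close>
  define t where "t d = card (nb d \<inter> {a, b, c})" for d
  have common: "y = x\<^sub>4" if "d \<frown> y" "d' \<frown> y" "x\<^sub>4 \<frown> d" "x\<^sub>4 \<frown> d'" "d \<noteq> d'" for d d' y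
    using no_quad that by blast
  have "d\<^sub>1 \<in> nb x\<^sub>4 - {v}" "d\<^sub>2 \<in> nb x\<^sub>4 - {v}" "d\<^sub>3 \<in> nb x\<^sub>4 - {v}"
    unfolding d(1) by simp_all
  then have x4d: "x\<^sub>4 \<frown> d\<^sub>1" "x\<^sub>4 \<frown> d\<^sub>2" "x\<^sub>4 \<frown> d\<^sub>3" and d_ne_v: "d\<^sub>1 \<noteq> v" "d\<^sub>2 \<noteq> v" "d\<^sub>3 \<noteq> v"
    by simp_all
  have disj: "(nb d \<inter> {a, b, c}) \<inter> (nb d' \<inter> {a, b, c}) = {}"
    if "x\<^sub>4 \<frown> d" "x\<^sub>4 \<frown> d'" "d \<noteq> d'" for d d'
  proof (rule ccontr)
    assume "(nb d \<inter> {a, b, c}) \<inter> (nb d' \<inter> {a, b, c}) \<noteq> {}"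
    then obtain y where y: "y \<in> {a, b, c}" "d \<frown> y" "d' \<frown> y"
      by (metis Int_iff all_not_in_conv mem_nb)
    have "y = x\<^sub>4" by (rule common[OF y(2,3) that])
    then show False using y(1) abc4 by simp
  qed
  let ?T = "\<lambda>d. nb d \<inter> {a, b, c}"
  have "t d\<^sub>1 + t d\<^sub>2 + t d\<^sub>3 = card (?T d\<^sub>1 \<union> ?T d\<^sub>2) + card (?T d\<^sub>3)"
    unfolding t_def by (subst card_Un_disjoint) (use disj x4d d(2) in auto)
  also have "\<dots> = card (?T d\<^sub>1 \<union> ?T d\<^sub>2 \<union> ?T d\<^sub>3)"
    using disj[OF x4d(1,3) d(3)] disj[OF x4d(2,3) d(4)]
    by (intro card_Un_disjoint[symmetric]) auto
  also have "\<dots> \<le> card {a, b, c}" by (rule card_mono) auto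
  also have "\<dots> \<le> 3" by (simp add: card_insert_if)
  \<comment> \<open>The three counts sum to at most 3, so two of the vertices keep at least one and
    two free neighbours; in the second case one remains even after avoiding the neighbours of
    \<open>z\<close>.\<close>
  finally have "(t d\<^sub>1 \<le> 2 \<and> t d\<^sub>2 \<le> 1) \<or> (t d\<^sub>2 \<le> 2 \<and> t d\<^sub>1 \<le> 1) \<or>
      (t d\<^sub>3 \<le> 2 \<and> t d\<^sub>1 \<le> 1) \<or> (t d\<^sub>3 \<le> 2 \<and> t d\<^sub>2 \<le> 1)"
    by linarith
  then obtain d d' where dd: "x\<^sub>4 \<frown> d" "x\<^sub>4 \<frown> d'" "d \<noteq> d'" "d \<noteq> v" "d' \<noteq> v" "t d \<le> 2" "t d' \<le> 1"
    using x4d d(2-4) d_ne_v by blast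
  have card_free: "card (nb d - {x\<^sub>4} - {a, b, c}) = 3 - t d" if "x\<^sub>4 \<frown> d" for d
  proof -
    have eq: "nb d - {x\<^sub>4} - {a, b, c} = (nb d - {x\<^sub>4}) - (nb d \<inter> {a, b, c})" by auto
    show ?thesis
      unfolding eq t_def using card_nb_minus[OF that] abc4 by (subst card_Diff_subset) auto
  qed
  have "1 \<le> card (nb d - {x\<^sub>4} - {a, b, c})" using card_free[OF dd(1)] dd(6) by simp
  then obtain z where z: "z \<in> nb d - {x\<^sub>4} - {a, b, c}" using nonempty by blast
  have ndd: "\<not> d \<frown> d'" by (rule xx[OF dd(1,2)])
  then have zd: "z \<noteq> d'" using z by auto
  have "2 \<le> card (nb d' - {x\<^sub>4} - {a, b, c})" using card_free[OF dd(2)] dd(7) by simp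
  then have "1 \<le> card (nb d' - {x\<^sub>4} - {a, b, c} - nb z)"
    using minus[of "nb d' - {x\<^sub>4} - {a, b, c}" d' z] zd by fastforce
  then obtain z' where z': "z' \<in> nb d' - {x\<^sub>4} - {a, b, c} - nb z" using nonempty by blast
  have adjz: "d \<frown> z" "d' \<frown> z'" and nzz: "\<not> z \<frown> z'" and z4: "z \<noteq> x\<^sub>4" "z' \<noteq> x\<^sub>4"
    and zabc: "z \<notin> {a, b, c}" "z' \<notin> {a, b, c}"
    using z z' by auto
  have nxx: "\<not> x\<^sub>1 \<frown> x\<^sub>2" "\<not> x\<^sub>1 \<frown> x\<^sub>3" "\<not> x\<^sub>2 \<frown> x\<^sub>3" "\<not> x\<^sub>2 \<frown> x\<^sub>1" "\<not> x\<^sub>3 \<frown> x\<^sub>1" "\<not> x\<^sub>3 \<frown> x\<^sub>2"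
    "\<not> x\<^sub>4 \<frown> x\<^sub>1" "\<not> x\<^sub>4 \<frown> x\<^sub>2" "\<not> x\<^sub>4 \<frown> x\<^sub>3"
    using xx[OF vx(1) vx(2)] xx[OF vx(1) vx(3)] xx[OF vx(2) vx(3)] xx[OF vx(2) vx(1)] xx[OF vx(3) vx(1)]
      xx[OF vx(3) vx(2)] xx[OF vx(4) vx(1)] xx[OF vx(4) vx(2)] xx[OF vx(4) vx(3)] by blast+
  have nxa: "\<not> x\<^sub>2 \<frown> a" "\<not> x\<^sub>3 \<frown> a" "\<not> x\<^sub>1 \<frown> b" "\<not> x\<^sub>3 \<frown> b" "\<not> x\<^sub>1 \<frown> c" "\<not> x\<^sub>2 \<frown> c"
    "\<not> x\<^sub>4 \<frown> a" "\<not> x\<^sub>4 \<frown> b" "\<not> x\<^sub>4 \<frown> c"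
    using far[OF adj3(1) nv3(1) vx(1) vx(2) x_ne(1)]
      far[OF adj3(1) nv3(1) vx(1) vx(3) x_ne(2)]
      far[OF adj3(2) nv3(2) vx(2) vx(1) x_ne(1)[symmetric]]
      far[OF adj3(2) nv3(2) vx(2) vx(3) x_ne(4)]
      far[OF adj3(3) nv3(3) vx(3) vx(1) x_ne(2)[symmetric]]
      far[OF adj3(3) nv3(3) vx(3) vx(2) x_ne(4)[symmetric]]
      far[OF adj3(1) nv3(1) vx(1) vx(4) x_ne(3)]
      far[OF adj3(2) nv3(2) vx(2) vx(4) x_ne(5)]
      far[OF adj3(3) nv3(3) vx(3) vx(4) x_ne(6)]
    by blast+
  have nxd: "\<not> x\<^sub>1 \<frown> d" "\<not> x\<^sub>2 \<frown> d" "\<not> x\<^sub>3 \<frown> d" "\<not> x\<^sub>1 \<frown> d'" "\<not> x\<^sub>2 \<frown> d'" "\<not> x\<^sub>3 \<frown> d'"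
    using far[OF dd(1) dd(4) vx(4) vx(1) x_ne(3)[symmetric]]
      far[OF dd(1) dd(4) vx(4) vx(2) x_ne(5)[symmetric]]
      far[OF dd(1) dd(4) vx(4) vx(3) x_ne(6)[symmetric]]
      far[OF dd(2) dd(5) vx(4) vx(1) x_ne(3)[symmetric]]
      far[OF dd(2) dd(5) vx(4) vx(2) x_ne(5)[symmetric]]
      far[OF dd(2) dd(5) vx(4) vx(3) x_ne(6)[symmetric]]
    by blast+
  have nv: "\<not> v \<frown> d" "\<not> v \<frown> d'" using no_triangle[OF vx(4)] dd(1,2) by blast+
  have ndz: "\<not> d \<frown> z'" "\<not> d' \<frown> z"
    using common[OF _ adjz(2) dd(1-3)] common[OF adjz(1) _ dd(1-3)] z4 by blast+
  have dist: "distinct [x\<^sub>1, x\<^sub>2, x\<^sub>3, a, b, c, d, d', z, z']"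
    using x_ne(1,2,4) adj3 nxx nxa nxd nv ndz adjz zabc dd(1-3) vx adj_sym ndd zd nzz
    by auto
  have vdist: "v \<notin> {x\<^sub>1, x\<^sub>2, x\<^sub>3, x\<^sub>4, a, b, c, d, d', z, z'}"
    using vx nv3 dd(4,5) nv adjz adj_sym by auto
  let ?e\<^sub>1 = "ed x\<^sub>1 a" and ?e\<^sub>2 = "ed x\<^sub>2 b" and ?e\<^sub>3 = "ed x\<^sub>3 c" and ?f = "ed d z" and ?f' = "ed d' z'"
  let ?P = "{?e\<^sub>1, ?e\<^sub>2, ?e\<^sub>3, ?f, ?f'}"
  \<comment> \<open>The pair is used only for the edge to \<open>x\<^sub>4\<close>. It has a colour
    of its own, so conflicts between pair and triple are harmless.\<close>
  let ?Y = "\<lambda>x. if x = x\<^sub>4 then {?e\<^sub>2, ?e\<^sub>3, ?f'} else {?e\<^sub>2, ?e\<^sub>3}"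
  let ?col = "\<lambda>e. if e = ?f \<or> e = ?f' then 1 else (0::nat)"
  have ed_ne: "distinct [?e\<^sub>1, ?e\<^sub>2, ?e\<^sub>3, ?f, ?f']"
    using dist adj3 adjz by (auto simp: ed_eq_iff doubleton_eq_iff)
  have inN: "{?e\<^sub>1, ?e\<^sub>2, ?e\<^sub>3} \<subseteq> N (ed v x)" if "v \<frown> x" for x
    using that adj3 nv3 vx in_N_ed_nb by auto
  have inN4: "{?f, ?f'} \<subseteq> N (ed v x\<^sub>4)"
    using vx dd adjz vdist by (auto simp: in_N_ed doubleton_eq_iff)
  show ?thesis
  proof (rule finish_four_quads[OF st, where P = ?P and c = ?col and Y = ?Y])
    show "matching ?P"
      using adj3 adjz dist by (auto simp: matching_insert)
    have "?e\<^sub>2 \<notin> N ?e\<^sub>1" "?e\<^sub>3 \<notin> N ?e\<^sub>1" "?e\<^sub>3 \<notin> N ?e\<^sub>2" "?f' \<notin> N ?f"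
      using adj3 adjz dist nxx nxa non3 ndd ndz nzz by (auto simp: in_N_ed adj_commute)
    then show "coloring_on ?P ?col"
      using adj3 adjz ed_ne by (auto simp: coloring_on_insert)
    show "?P \<inter> St v = {}"
      using adj3 adjz vdist by (auto simp: notin_St_iff)
    show "?Y x \<subseteq> N (ed v x) \<inter> ?P" if "v \<frown> x" for x
      using inN[OF that] inN4 by auto
    show "\<exists>z\<in>N (ed v x) \<inter> ?P - ?Y x. ?col z = ?col y" if "v \<frown> x" "y \<in> ?Y x" for x y
    proof (cases "y = ?f'")
      case True
      then have "x = x\<^sub>4" using that(2) ed_ne by (auto split: if_splits)
      then show ?thesis using inN4 True ed_ne by (intro bexI[of _ ?f]) auto
    next
      case False
      then have "y = ?e\<^sub>2 \<or> y = ?e\<^sub>3" using that(2) by (auto split: if_splits)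
      then show ?thesis using inN[OF that(1)] ed_ne by (intro bexI[of _ ?e\<^sub>1]) auto
    qed
  qed (use ed_ne x_ne in simp_all)
qed

lemma triangle_free_colorable: colorable
proof (cases "E = {}")
  case True
  then show ?thesis unfolding coloring_on_def by simp
next
  case False
  then obtain e where "e \<in> E" by blast
  moreover obtain v x where "ep e = {v, x}" by (rule endpointsE)
  ultimately have "v \<frown> x" by (auto simp: adj_def)
  show ?thesis
  proof (rule ccontr)
    assume nc: "\<not> colorable"
    have "w = v" if "v \<frown> x" "v \<frown> y" "x \<noteq> y" "x \<frown> w" "y \<frown> w" for v x y w
      using colorable_of_quad[OF that] nc by blast
    then show False using colorable_of_no_quad[OF \<open>v \<frown> x\<close>] nc by blast
  qed
qed

end

section \<open>Combining the cases\<close>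

text \<open>An uncolourable graph has no triangle, so it satisfies the assumptions of the stronger
  locale.\<close>

lemma (in simple_regular) simple_regular_colorable: colorable
proof (rule ccontr)
  assume nc: "\<not> colorable"
  interpret triangle_free E ends
    by unfold_locales (use nc colorable_of_triangle in blast)
  show False using nc triangle_free_colorable by simp
qed

lemma (in bounded_multigraph) bounded_multigraph_colorable: colorable
proof (rule ccontr)
  assume nc: "\<not> colorable"
  interpret simple_regular E ends
  proof unfold_locales
    show "\<not> u \<frown> u" for u
      using nc colorable_of_loop by (auto simp: adj_def)
    show "e = f" if "e \<in> E" "f \<in> E" "ep e = ep f" for e f
      using nc colorable_of_parallel that endpointsE by metis
    show "card (St u) = 4" if "St u \<noteq> {}" for u
      using nc colorable_of_small_star[OF that] card_St_le[of u] by fastforce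
  qed
  show False using nc simple_regular_colorable by simp
qed

section \<open>Reduction to connected graphs\<close>

lemma degree_mono:
  assumes "finite E" "F \<subseteq> E"
  shows "degree F ends v \<le> degree E ends v"
  unfolding degree_def using assms by (intro add_mono card_mono) auto

text \<open>No conflict crosses between components, so the edges \<open>F\<close> of one component
  and the remaining edges can use the same 22 colours by induction.\<close>

lemma strong_edge_coloring_22:
  fixes ends :: "'e \<Rightarrow> 'v \<times> 'v"
  assumes "finite E" "\<And>v. degree E ends v \<le> 4"
  shows "\<exists>c :: 'e \<Rightarrow> nat. c ` E \<subseteq> {..<22} \<and> strong_edge_coloring E ends c"
  using assms
proof (induction E rule: finite_psubset_induct)
  case (psubset E)
  let ?R = "{(p, q). adj E ends p q}"
  show ?case
  proof (cases "\<forall>u w. star E ends u \<noteq> {} \<longrightarrow> star E ends w \<noteq> {} \<longrightarrow> (u, w) \<in> ?R\<^sup>*")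
    case True
    interpret bounded_multigraph E ends
      using True psubset.hyps psubset.prems by unfold_locales auto
    from bounded_multigraph_colorable obtain c where "coloring_on E c" by blast
    then show ?thesis
      by (intro exI[of _ c]) (auto simp: coloring_on_def strong_edge_coloring_def N_def)
  next
    case False
    then obtain u w where uw: "star E ends u \<noteq> {}" "star E ends w \<noteq> {}" "(u, w) \<notin> ?R\<^sup>*" by blast
    define X where "X = {q. (u, q) \<in> ?R\<^sup>*}"
    have X: "p \<in> X \<longleftrightarrow> q \<in> X" if "adj E ends p q" for p q
      using that adj_commute[of E ends p q] unfolding X_def by (auto intro: rtrancl_into_rtrancl)
    define F where "F = {e \<in> E. fst (ends e) \<in> X}"
    have inX: "p \<in> X \<longleftrightarrow> e \<in> F" if "e \<in> E" "p \<in> endpoints ends e" for e p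
    proof -
      have "adj E ends (fst (ends e)) (snd (ends e))"
        using that(1) by (auto simp: adj_def endpoints_def)
      then show ?thesis using that X by (auto simp: F_def endpoints_def)
    qed
    have "u \<in> X" "w \<notin> X" using uw(3) by (auto simp: X_def)
    then have "F \<noteq> {}" "F \<noteq> E" using uw(1,2) inX by (auto simp: star_def)
    then have psub: "F \<subset> E" "E - F \<subset> E" by (auto simp: F_def)
    have deg: "degree G ends v \<le> 4" if "G \<subset> E" for G v
      using degree_mono[of E G ends v] psubset.hyps psubset.prems[of v] that by force
    obtain c\<^sub>1 c\<^sub>2 :: "'e \<Rightarrow> nat"
      where c1: "c\<^sub>1 ` F \<subseteq> {..<22}" "strong_edge_coloring F ends c\<^sub>1"
        and c2: "c\<^sub>2 ` (E - F) \<subseteq> {..<22}" "strong_edge_coloring (E - F) ends c\<^sub>2"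
      using psubset.IH[OF psub(1) deg[OF psub(1)]] psubset.IH[OF psub(2) deg[OF psub(2)]] by blast
    let ?c = "\<lambda>e. if e \<in> F then c\<^sub>1 e else c\<^sub>2 e"
    have "strong_edge_coloring E ends ?c"
      unfolding strong_edge_coloring_def
    proof (intro ballI impI, elim conjE)
      fix e f assume ef: "e \<in> E" "f \<in> E" "e \<noteq> f" "strong_conflict E ends e f"
      then obtain p q where pq: "p \<in> endpoints ends e" "q \<in> endpoints ends f"
        "p = q \<or> adj E ends p q"
        by (auto simp: strong_conflict_iff)
      have same: "e \<in> F \<longleftrightarrow> f \<in> F"
        using inX[OF ef(1) pq(1)] inX[OF ef(2) pq(2)] X pq(3) by blast
      \<comment> \<open>The joining edge lies in the same part, so the conflict persists in the
        smaller edge set.\<close>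
      have "p = q \<or> adj (if e \<in> F then F else E - F) ends p q"
      proof (cases "p = q")
        case False
        then obtain g where g: "g \<in> E" "endpoints ends g = {p, q}"
          using pq(3) by (auto simp: adj_def)
        then have "g \<in> F \<longleftrightarrow> e \<in> F"
          using inX[OF g(1), of p] inX[OF ef(1) pq(1)] by simp
        then show ?thesis using g by (auto simp: adj_def)
      qed simp
      then have "strong_conflict (if e \<in> F then F else E - F) ends e f"
        unfolding strong_conflict_iff using pq(1,2) by blast
      then show "?c e \<noteq> ?c f"
        using c1(2) c2(2) ef(1-3) same by (auto simp: strong_edge_coloring_def split: if_splits)
    qed
    moreover have "?c ` E \<subseteq> {..<22}" using c1(1) c2(1) by auto
    ultimately show ?thesis by blast
  qed
qed

theorem theorem1:
  fixes V :: "'v set" and E :: "'e set" and ends :: "'e \<Rightarrow> 'v \<times> 'v"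
  assumes "multigraph V E ends"
    and "max_degree V E ends = 4"
  shows "\<exists>c :: 'e \<Rightarrow> nat. strong_edge_coloring E ends c \<and> card (c ` E) \<le> 22"
proof -
  have fin: "finite V" "finite E" and V: "\<And>e. e \<in> E \<Longrightarrow> fst (ends e) \<in> V \<and> snd (ends e) \<in> V"
    using assms(1) by (auto simp: multigraph_def)
  \<comment> \<open>\<open>max_degree\<close> ranges over \<open>V\<close> only; elements outside
    \<open>V\<close> have degree 0.\<close>
  have "degree E ends v \<le> 4" for v
  proof (cases "v \<in> V")
    case True
    then have "degree E ends v \<le> Max (insert 0 (degree E ends ` V))"
      using fin(1) by (intro Max_ge) auto
    then show ?thesis using assms(2) by (simp add: max_degree_def)
  next
    case False
    then have "{e \<in> E. fst (ends e) = v} = {}" "{e \<in> E. snd (ends e) = v} = {}"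
      using V by auto
    then show ?thesis by (simp only: degree_def card.empty add_0 zero_le)
  qed
  then obtain c :: "'e \<Rightarrow> nat" where c: "c ` E \<subseteq> {..<22}" "strong_edge_coloring E ends c"
    using strong_edge_coloring_22[OF fin(2)] by blast
  have "card (c ` E) \<le> card {..<22 :: nat}"
    using c(1) by (intro card_mono) simp_all
  then show ?thesis using c(2) by auto
qed

end
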